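(* Let $\mu=-1$ and let $y=y(x)$ be a (branch of a) solution of $PVI_{\mu}$ with $\mu=-1$. For pairwise distinct $u_1,u_2,u_3$ put $x=\frac{u_3-u_1}{u_2-u_1}$, $H=u_2-u_1$, and let $E_{ij}$ and $a,b,b_1,a_1,b_2,c$ be the functions of $x$ defined from $y$ and $\frac{dy}{dx}$ in the context. Put $$f(x,H)=\frac H3\,b(x),$$ $$t^1=u_1+a(x)H,\qquad t^2=3\ln(H)+3\int^x\frac{d\zeta}{\zeta+\frac{E_{21}E_{22}}{E_{31}E_{32}}},\qquad t^3=-c(x)\frac{H}{f^2}=-9\,\frac{c(x)}{b(x)^2}\,\frac1H,$$ $$F=\frac12t^1(t^2)^2+\frac12(t^1)^2t^3+\left[\frac16a_1(x)c(x)^2+\frac34b(x)b_1(x)c(x)+(b_2(x)-a(x))\,b(x)^2\right]\frac{H^3}{f^2},$$ where in the integrand the $E_{ij}$ are evaluated at $\zeta$. Then, locally near any point $(u_1,u_2,u_3)$ at which these expressions are holomorphic and $E_{11}E_{21}E_{31}\ne0$, these formulae are a parametric representation of a solution $F=F(t^1,t^2,t^3)$ of the WDVV equations with $d=2$, charges $(q_1,q_2,q_3)=(0,1,2)$ and Euler vector field $t^1\partial_1+3\partial_2-t^3\partial_3$ (the case of the quantum cohomology of $\mathbb{CP}^2$). Moreover $e^{t^2}(t^3)^3$ is independent of $H$, and $F(t)=\frac12t^1(t^2)^2+\frac12(t^1)^2t^3+\frac1{t^3}\varphi\bigl(e^{t^2}(t^3)^3\bigr)$ for some function $\varphi$.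
   Context: $PVI_\mu$ is the Painlevé VI equation $$\frac{d^2y}{dx^2}=\frac12\left[\frac1y+\frac1{y-1}+\frac1{y-x}\right]\left(\frac{dy}{dx}\right)^2-\left[\frac1x+\frac1{x-1}+\frac1{y-x}\right]\frac{dy}{dx}+\frac12\,\frac{y(y-1)(y-x)}{x^2(x-1)^2}\left[(2\mu-1)^2+\frac{x(x-1)}{(y-x)^2}\right].$$ WDVV equations (here in dimension 3, $\eta_{\alpha\beta}=\delta_{\alpha+\beta,4}$, $(\eta^{\alpha\beta})=(\eta_{\alpha\beta})^{-1}$, $\partial_\alpha=\partial/\partial t^\alpha$): for all $\alpha,\beta,\gamma,\delta$, $\partial_\alpha\partial_\beta\partial_\lambda F\,\eta^{\lambda\nu}\,\partial_\nu\partial_\gamma\partial_\delta F$ (summed over $\lambda,\nu$) is symmetric under exchange of $\alpha$ and $\delta$; $\partial_1\partial_\alpha\partial_\beta F=\eta_{\alpha\beta}$; and quasi-homogeneity $E(F)=(3-d)F$ up to at most quadratic terms, $E$ being the Euler vector field. Definitions from $y$ (with $\mu=-1$). Put $A(x)=\frac12\left[\frac{dy}{dx}x(x-1)-y(y-1)\right]$ and $$\Omega_1=i\frac{\sqrt{y-1}\sqrt{y-x}}{\sqrt x}\left[\frac{A}{(y-1)(y-x)}+\mu\right],\quad\Omega_2=i\frac{\sqrt y\sqrt{y-x}}{\sqrt{1-x}}\left[\frac{A}{y(y-x)}+\mu\right],\quad\Omega_3=-\frac{\sqrt y\sqrt{y-1}}{\sqrt x\sqrt{1-x}}\left[\frac{A}{y(y-1)}+\mu\right]$$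 (the same, arbitrarily chosen, branch of each square root is used throughout). Put $$E_{i2}=\frac{\Omega_i}{i\mu}\ (i=1,2,3),\quad E_{11}=\frac{\Omega_1\Omega_2-\mu\Omega_3}{2\mu^2},\quad E_{21}=-\frac{\Omega_1^2+\Omega_3^2}{2\mu^2},\quad E_{31}=\frac{\Omega_2\Omega_3+\mu\Omega_1}{2\mu^2},$$ $$E_{13}=-\frac{\Omega_1\Omega_2+\mu\Omega_3}{\Omega_1^2+\Omega_3^2},\quad E_{23}=1,\quad E_{33}=-\frac{\Omega_2\Omega_3-\mu\Omega_1}{\Omega_1^2+\Omega_3^2},$$ $$a=E_{21}E_{23}+xE_{31}E_{33},\quad b=E_{22}E_{21}+xE_{32}E_{31},\quad b_1=E_{23}E_{22}+xE_{33}E_{32},$$ $$a_1=E_{23}^2+xE_{33}^2,\quad b_2=E_{22}^2+xE_{32}^2,\quad c=E_{21}^2+xE_{31}^2.$$ *)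

theory Defs
  imports "HOL-Complex_Analysis.Complex_Analysis"
begin

unbundle no Formal_Power_Series.fps_syntax

section \<open>The Painleve VI equation and the functions built from a solution\<close>

definition PVI_solution :: "complex \<Rightarrow> (complex \<Rightarrow> complex) \<Rightarrow> complex set \<Rightarrow> bool" where
  "PVI_solution \<mu> y V \<longleftrightarrow> y holomorphic_on V \<and>
    (\<forall>x\<in>V. x \<noteq> 0 \<and> x \<noteq> 1 \<and> y x \<noteq> 0 \<and> y x \<noteq> 1 \<and> y x \<noteq> x \<and>
      deriv (deriv y) x =
        (1/2) * (1 / y x + 1 / (y x - 1) + 1 / (y x - x)) * (deriv y x)^2
        - (1 / x + 1 / (x - 1) + 1 / (y x - x)) * deriv y x
        + (1/2) * (y x * (y x - 1) * (y x - x) / (x^2 * (x - 1)^2))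
            * ((2 * \<mu> - 1)^2 + x * (x - 1) / (y x - x)^2))"

definition sqrt_branch :: "(complex \<Rightarrow> complex) \<Rightarrow> (complex \<Rightarrow> complex) \<Rightarrow> complex set \<Rightarrow> bool" where
  "sqrt_branch s g V \<longleftrightarrow> s holomorphic_on V \<and> (\<forall>x\<in>V. (s x)^2 = g x)"

definition log_branch :: "(complex \<Rightarrow> complex) \<Rightarrow> complex set \<Rightarrow> bool" where
  "log_branch L \<Lambda> \<longleftrightarrow> L holomorphic_on \<Lambda> \<and> (\<forall>h\<in>\<Lambda>. exp (L h) = h)"

definition A_fun :: "(complex \<Rightarrow> complex) \<Rightarrow> complex \<Rightarrow> complex" where
  "A_fun y x = (1/2) * (deriv y x * x * (x - 1) - y x * (y x - 1))"

text \<open>The arguments \<open>sx\<close>, \<open>s1x\<close>, \<open>sy\<close>, \<open>sy1\<close>, \<open>syx\<close> are the chosen branches of the square roots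
  of \<open>x\<close>, \<open>1 - x\<close>, \<open>y\<close>, \<open>y - 1\<close> and \<open>y - x\<close>.\<close>

definition Omega1 where
  "Omega1 (\<mu>::complex) y sy1 syx sx x =
     \<i> * (sy1 x * syx x / sx x) * (A_fun y x / ((y x - 1) * (y x - x)) + \<mu>)"

definition Omega2 where
  "Omega2 (\<mu>::complex) y sy syx s1x x =
     \<i> * (sy x * syx x / s1x x) * (A_fun y x / (y x * (y x - x)) + \<mu>)"

definition Omega3 where
  "Omega3 (\<mu>::complex) y sy sy1 sx s1x x =
     - (sy x * sy1 x / (sx x * s1x x)) * (A_fun y x / (y x * (y x - 1)) + \<mu>)"

definition E_matrix :: "complex \<Rightarrow> complex \<Rightarrow> complex \<Rightarrow> complex \<Rightarrow> complex^3^3" where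
  "E_matrix \<mu> w1 w2 w3 = vector [
     vector [(w1 * w2 - \<mu> * w3) / (2 * \<mu>^2),  w1 / (\<i> * \<mu>),
             - (w1 * w2 + \<mu> * w3) / (w1^2 + w3^2)],
     vector [- (w1^2 + w3^2) / (2 * \<mu>^2),  w2 / (\<i> * \<mu>),  1],
     vector [(w2 * w3 + \<mu> * w1) / (2 * \<mu>^2),  w3 / (\<i> * \<mu>),
             - (w2 * w3 - \<mu> * w1) / (w1^2 + w3^2)]]"

definition a_fun :: "(complex \<Rightarrow> complex^3^3) \<Rightarrow> complex \<Rightarrow> complex" where
  "a_fun E x = E x $ 2 $ 1 * E x $ 2 $ 3 + x * E x $ 3 $ 1 * E x $ 3 $ 3"

definition b_fun :: "(complex \<Rightarrow> complex^3^3) \<Rightarrow> complex \<Rightarrow> complex" where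
  "b_fun E x = E x $ 2 $ 2 * E x $ 2 $ 1 + x * E x $ 3 $ 2 * E x $ 3 $ 1"

definition b1_fun :: "(complex \<Rightarrow> complex^3^3) \<Rightarrow> complex \<Rightarrow> complex" where
  "b1_fun E x = E x $ 2 $ 3 * E x $ 2 $ 2 + x * E x $ 3 $ 3 * E x $ 3 $ 2"

definition a1_fun :: "(complex \<Rightarrow> complex^3^3) \<Rightarrow> complex \<Rightarrow> complex" where
  "a1_fun E x = (E x $ 2 $ 3)^2 + x * (E x $ 3 $ 3)^2"

definition b2_fun :: "(complex \<Rightarrow> complex^3^3) \<Rightarrow> complex \<Rightarrow> complex" where
  "b2_fun E x = (E x $ 2 $ 2)^2 + x * (E x $ 3 $ 2)^2"

definition c_fun :: "(complex \<Rightarrow> complex^3^3) \<Rightarrow> complex \<Rightarrow> complex" where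
  "c_fun E x = (E x $ 2 $ 1)^2 + x * (E x $ 3 $ 1)^2"

section \<open>The parametric formulae\<close>

definition x_of :: "complex^3 \<Rightarrow> complex" where
  "x_of u = (u $ 3 - u $ 1) / (u $ 2 - u $ 1)"

definition H_of :: "complex^3 \<Rightarrow> complex" where
  "H_of u = u $ 2 - u $ 1"

definition f_fun :: "(complex \<Rightarrow> complex^3^3) \<Rightarrow> complex \<Rightarrow> complex \<Rightarrow> complex" where
  "f_fun E x H = H / 3 * b_fun E x"

text \<open>\<open>L\<close> is a branch of the logarithm and \<open>T\<close> a primitive of
  \<open>1 / (x + E\<^sub>2\<^sub>1 E\<^sub>2\<^sub>2 / (E\<^sub>3\<^sub>1 E\<^sub>3\<^sub>2))\<close>. The functions \<open>E\<close> and \<open>T\<close> may be analytic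
  continuations from the open set where their formulae in \<open>y\<close> make literal sense, so that
  removable singularities (zeros of \<open>y\<close>, \<open>y - 1\<close>, \<open>y - x\<close>, \<open>E\<^sub>3\<^sub>2\<close>) are not excluded.\<close>

definition t2_fun :: "(complex \<Rightarrow> complex) \<Rightarrow> (complex \<Rightarrow> complex) \<Rightarrow> complex \<Rightarrow> complex \<Rightarrow> complex" where
  "t2_fun L T x H = 3 * L H + 3 * T x"

definition t3_fun :: "(complex \<Rightarrow> complex^3^3) \<Rightarrow> complex \<Rightarrow> complex \<Rightarrow> complex" where
  "t3_fun E x H = - c_fun E x * (H / (f_fun E x H)^2)"

definition t_map :: "(complex \<Rightarrow> complex^3^3) \<Rightarrow> (complex \<Rightarrow> complex) \<Rightarrow> (complex \<Rightarrow> complex)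
    \<Rightarrow> complex^3 \<Rightarrow> complex^3" where
  "t_map E L T u = vector [u $ 1 + a_fun E (x_of u) * H_of u,
                           t2_fun L T (x_of u) (H_of u),
                           t3_fun E (x_of u) (H_of u)]"

definition F_param :: "(complex \<Rightarrow> complex^3^3) \<Rightarrow> (complex \<Rightarrow> complex) \<Rightarrow> (complex \<Rightarrow> complex)
    \<Rightarrow> complex^3 \<Rightarrow> complex" where
  "F_param E L T u =
    (let x = x_of u; H = H_of u; t = t_map E L T u in
       1/2 * t $ 1 * (t $ 2)^2 + 1/2 * (t $ 1)^2 * t $ 3
       + (1/6 * a1_fun E x * (c_fun E x)^2 + 3/4 * b_fun E x * b1_fun E x * c_fun E x
          + (b2_fun E x - a_fun E x) * (b_fun E x)^2) * (H^3 / (f_fun E x H)^2))"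

text \<open>The points at which \<open>t_map\<close> and \<open>F_param\<close> are given by the formulae without division by zero.\<close>

definition u_domain :: "(complex \<Rightarrow> complex^3^3) \<Rightarrow> complex set \<Rightarrow> complex set \<Rightarrow> (complex^3) set" where
  "u_domain E U \<Lambda> = {u. u $ 1 \<noteq> u $ 2 \<and> u $ 1 \<noteq> u $ 3 \<and> u $ 2 \<noteq> u $ 3 \<and>
      x_of u \<in> U \<and> H_of u \<in> \<Lambda> \<and> b_fun E (x_of u) \<noteq> 0}"

section \<open>Holomorphic functions of three variables and the WDVV equations\<close>

definition holomorphic_C3 :: "(complex^3 \<Rightarrow> complex) \<Rightarrow> (complex^3) set \<Rightarrow> bool" where
  "holomorphic_C3 f W \<longleftrightarrow>
     (\<forall>p\<in>W. \<exists>D. (f has_derivative D) (at p) \<and> (\<forall>k v. D (k *s v) = k * D v))"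

definition biholomorphic_C3 :: "(complex^3 \<Rightarrow> complex^3) \<Rightarrow> (complex^3) set \<Rightarrow> (complex^3) set \<Rightarrow> bool" where
  "biholomorphic_C3 g N W \<longleftrightarrow> bij_betw g N W \<and>
     (\<forall>i. holomorphic_C3 (\<lambda>u. g u $ i) N) \<and>
     (\<forall>i. holomorphic_C3 (\<lambda>t. inv_into N g t $ i) W)"

definition pd :: "3 \<Rightarrow> (complex^3 \<Rightarrow> complex) \<Rightarrow> complex^3 \<Rightarrow> complex" where
  "pd \<alpha> F t = deriv (\<lambda>z. F (t + axis \<alpha> z)) 0"

text \<open>The indices are added in the three-element type, hence modulo 3; among the sums
  of two indices from 1 to 3, only 4 itself is congruent to 4 modulo 3.\<close>

definition eta :: "complex^3^3" where
  "eta = (\<chi> \<alpha> \<beta>. if \<alpha> + \<beta> = 4 then 1 else 0)"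

text \<open>\<open>Eu\<close> is an Euler vector field for the charge \<open>d\<close> and the charges \<open>q\<close>:
  its components are \<open>(1 - q\<^sub>\<alpha>) t\<^sup>\<alpha> + r\<^sub>\<alpha>\<close> with \<open>r\<^sub>\<alpha> \<noteq> 0\<close> only if \<open>q\<^sub>\<alpha> = 1\<close>.\<close>

definition euler_vector_field :: "complex \<Rightarrow> complex^3 \<Rightarrow> (complex^3 \<Rightarrow> complex^3) \<Rightarrow> bool" where
  "euler_vector_field d q Eu \<longleftrightarrow>
     q $ 1 = 0 \<and> (\<forall>\<alpha> \<beta>. \<alpha> + \<beta> = 4 \<longrightarrow> q $ \<alpha> + q $ \<beta> = d) \<and>
     (\<exists>r :: complex^3. (\<forall>\<alpha>. q $ \<alpha> \<noteq> 1 \<longrightarrow> r $ \<alpha> = 0) \<and>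
        (\<forall>t. Eu t = (\<chi> \<alpha>. (1 - q $ \<alpha>) * t $ \<alpha> + r $ \<alpha>)))"

definition WDVV_solution :: "complex \<Rightarrow> complex^3 \<Rightarrow> (complex^3 \<Rightarrow> complex^3)
    \<Rightarrow> (complex^3 \<Rightarrow> complex) \<Rightarrow> (complex^3) set \<Rightarrow> bool" where
  "WDVV_solution d q Eu F W \<longleftrightarrow>
     holomorphic_C3 F W \<and>
     euler_vector_field d q Eu \<and>
     (\<forall>t\<in>W. \<forall>\<alpha> \<beta> \<gamma> \<delta>.
        (\<Sum>\<kappa>\<in>UNIV. \<Sum>\<nu>\<in>UNIV. pd \<alpha> (pd \<beta> (pd \<kappa> F)) t * matrix_inv eta $ \<kappa> $ \<nu> * pd \<nu> (pd \<gamma> (pd \<delta> F)) t) =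
        (\<Sum>\<kappa>\<in>UNIV. \<Sum>\<nu>\<in>UNIV. pd \<delta> (pd \<beta> (pd \<kappa> F)) t * matrix_inv eta $ \<kappa> $ \<nu> * pd \<nu> (pd \<gamma> (pd \<alpha> F)) t)) \<and>
     (\<forall>t\<in>W. \<forall>\<alpha> \<beta>. pd 1 (pd \<alpha> (pd \<beta> F)) t = eta $ \<alpha> $ \<beta>) \<and>
     (\<exists>(Q :: complex^3^3) (B :: complex^3) C. \<forall>t\<in>W.
        (\<Sum>\<alpha>\<in>UNIV. Eu t $ \<alpha> * pd \<alpha> F t) =
          (3 - d) * F t + (\<Sum>\<alpha>\<in>UNIV. \<Sum>\<beta>\<in>UNIV. Q $ \<alpha> $ \<beta> * t $ \<alpha> * t $ \<beta>)
            + (\<Sum>\<alpha>\<in>UNIV. B $ \<alpha> * t $ \<alpha>) + C)"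

end

(*
  Writing PVI_mu (mu = -1) as a polynomial Hamiltonian system shows that the Omega_i satisfy the
  Euler-top system x Omega_1' = Omega_2 Omega_3, (1-x) Omega_2' = Omega_1 Omega_3,
  x(x-1) Omega_3' = Omega_1 Omega_2 on the level set Omega_1^2 + Omega_2^2 + Omega_3^2 = -1.
  Everything else is algebra in the Omega_i, and extends from V to U by the identity theorem.
  The matrix psi with columns E_i1/f, E_i2, f E_i3 then satisfies psi^T psi = eta, the formulae for
  t^1, t^2, t^3 satisfy dt^alpha = sum_i psi_i1 psi_i,4-alpha du_i, and the functions
  c_abc = sum_i psi_ia psi_ib psi_ic / psi_i1 are the third derivatives of F.  Associativity and the
  unit equation are immediate from orthogonality, and the Euler field, acting as sum_i u_i d/du_i,
  recovers F from its second derivatives by pure algebra.  The quantity e^(t^2) (t^3)^3 depends on x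
  only, and its logarithmic derivative is 3i E_11 E_21 E_31 / (b c), which is nonzero; so x, and hence
  t^3 (F - cubic part), is locally a function of it.
*)
theory Submission
  imports Defs
begin

section \<open>The Hamiltonian form of Painleve VI and the Omega system\<close>

text \<open>Outside \<open>V\<close> neither \<open>y\<close> nor the roots need exist, whereas
  \<open>E\<close> and \<open>T\<close> do. Hence everything proved after the Omega system starts
  from relations between \<open>x\<close>, \<open>E\<close> and derivatives of \<open>E\<close> and
  \<open>T\<close> alone, in a form that makes sense at every point of \<open>U\<close>. Write
  \<open>w\<close> for the second column of \<open>E\<close>. The three columns are eigenvectors of
  the skew map \<open>v \<mapsto> v \<times> w\<close> with eigenvalues \<open>\<i>\<close>, 0,
  \<open>-\<i>\<close>; orthogonality relations and derivatives of all coefficients follow from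
  this. The coefficient \<open>b\<close> pairs the columns with eigenvalues \<open>\<i>\<close> and
  0, and this is the pair whose derivative has no inhomogeneous term, so \<open>b\<close> can serve
  as normalising factor of the frame. The 3 in \<open>f = H b / 3\<close> is the constant component
  of the Euler field. No integration of closed forms is needed for F: the homogeneity weights of the
  second derivatives with indices 2 and 3 are 1, 2, 3, those of the corresponding first derivatives
  are 1, 2, and that of F is 1. Weight 0 occurs only for \<open>\<partial>1 F\<close> and
  \<open>\<partial>1 \<partial>2 F\<close>, which the unit equation gives explicitly.\<close>

lemma sqrt_branch_has_field_derivative:
  assumes "sqrt_branch s g V" "open V" "x \<in> V" "(g has_field_derivative g') (at x)" "g x \<noteq> 0"
  shows "(s has_field_derivative s x * g' / (2 * g x)) (at x)" and "s x \<noteq> 0"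
proof -
  have hol: "s holomorphic_on V" and sq: "\<And>z. z \<in> V \<Longrightarrow> (s z)\<^sup>2 = g z"
    using assms(1) by (auto simp: sqrt_branch_def)
  show nz: "s x \<noteq> 0" using sq[OF assms(3)] assms(5) by auto
  have ds: "(s has_field_derivative deriv s x) (at x)"
    by (rule holomorphic_derivI[OF hol assms(2,3)])
  have "((\<lambda>z. (s z)\<^sup>2) has_field_derivative 2 * s x * deriv s x) (at x)"
    by (rule derivative_eq_intros ds refl | simp)+
  then have "(g has_field_derivative 2 * s x * deriv s x) (at x)"
    by (rule has_field_derivative_transform_within_open[OF _ assms(2,3)]) (simp add: sq)
  then have "2 * s x * deriv s x = g'" using assms(4) DERIV_unique by blast
  then have "deriv s x = s x * g' / (2 * g x)"
    using nz sq[OF assms(3), symmetric] by (simp add: field_simps power2_eq_square)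
  then show "(s has_field_derivative s x * g' / (2 * g x)) (at x)" using ds by simp
qed

text \<open>\<open>Y\<close>, \<open>Z\<close>, \<open>Y2\<close> stand for y, y', y'', and 9 is
  \<open>(2 \<mu> - 1)^2\<close> at \<open>\<mu> = -1\<close>. After multiplication by the square of
  \<open>x (x - 1)\<close> and elimination of \<open>Z\<close> in favour of \<open>p\<close>, the
  poles of the equation at \<open>Y = 0, 1, x\<close> cancel, which leaves Hamilton's
  equations.\<close>

lemma PVI_Hamiltonian_identities:
  fixes x Y Z Y2 A p :: complex
  assumes nz: "x \<noteq> 0" "x \<noteq> 1" "Y \<noteq> 0" "Y \<noteq> 1" "Y \<noteq> x"
    and eq: "Y2 = (1/2) * (1 / Y + 1 / (Y - 1) + 1 / (Y - x)) * Z^2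
        - (1 / x + 1 / (x - 1) + 1 / (Y - x)) * Z
        + (1/2) * (Y * (Y - 1) * (Y - x) / (x^2 * (x - 1)^2))
            * (9 + x * (x - 1) / (Y - x)^2)"
    and A: "A = (1/2) * (Z * x * (x - 1) - Y * (Y - 1))"
    and p: "p = A / (Y * (Y - 1) * (Y - x))"
    and A': "A' = (1/2) * ((Y2 * x + Z) * (x - 1) + Z * x - (Z * (Y - 1) + Y * Z))"
  shows "Z = (2 * (Y * (Y - 1) * (Y - x)) * p + Y * (Y - 1)) / (x * (x - 1))" (is ?Z)
    and "(A' - p * (Z * (Y - 1) * (Y - x) + Y * Z * (Y - x) + Y * (Y - 1) * (Z - 1))) / (Y * (Y - 1) * (Y - x))
       = (2 + (1 - 2 * Y) * p - (3 * Y^2 - 2 * (1 + x) * Y + x) * p^2) / (x * (x - 1))"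
proof -
  have nz': "x - 1 \<noteq> 0" "Y - 1 \<noteq> 0" "Y - x \<noteq> 0" using nz by auto
  define D where "D = x * (x - 1)"
  define R where "R = Y * (Y - 1) * (Y - x)"
  have D0: "D \<noteq> 0" and R0: "R \<noteq> 0" using nz nz' by (auto simp: D_def R_def)
  have Ap: "A = R * p" using p R0 by (simp add: R_def)
  have DZ: "D * Z = 2 * R * p + Y * (Y - 1)" using A unfolding Ap D_def by (simp add: field_simps)
  then show ?Z using D0 by (simp add: D_def R_def field_simps)
  \<comment> \<open>The pole at \<open>Y = x\<close> is isolated in \<open>\<kappa>\<close>:
    \<open>D\<close>, \<open>R\<close>, \<open>s\<close> and \<open>q\<close> become polynomials in
    \<open>Y - x\<close>, \<open>\<kappa>\<close>, \<open>x\<close> and \<open>Y\<close>. The sum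
    \<open>i\<close> of the reciprocals enters only multiplied by \<open>q\<close> or
    \<open>R\<close>, where it is harmless; \<open>\<kappa>\<close> cancels in
    \<open>D * A'\<close>.\<close>
  define q \<kappa> s where "q = Y * (Y - 1)" and "\<kappa> = q / (Y - x)" and "s = 3 * Y^2 - 2 * (1 + x) * Y + x"
  define i where "i = 1 / Y + 1 / (Y - 1) + 1 / (Y - x)"
  have q: "q = \<kappa> * (Y - x)" and R: "R = q * (Y - x)" using nz' by (auto simp: \<kappa>_def R_def q_def)
  have s: "s = (2 * Y - 1) * (Y - x) + q" unfolding s_def q_def by algebra
  have D: "D = (Y - x) * (\<kappa> - (x + Y - 1))"
    using q unfolding D_def q_def by algebra
  have iq: "i * q = 2 * Y - 1 + \<kappa>" using nz nz' unfolding i_def \<kappa>_def q_def by (simp add: distrib_right)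
  have iR: "i * R = s" unfolding R s using iq q by algebra
  have DZ': "D * Z = 2 * R * p + q" using DZ by (simp add: q_def)
  have Y2: "D^2 * Y2 = (1/2) * (i * (D * Z)^2) - (2 * x - 1 + (\<kappa> - (x + Y - 1))) * (D * Z)
      + (1/2) * (9 * R + q * (\<kappa> - (x + Y - 1)))"
  proof -
    have "D^2 * ((1 / x + 1 / (x - 1) + 1 / (Y - x)) * Z) = (D * (1 / x + 1 / (x - 1) + 1 / (Y - x))) * (D * Z)"
      by (simp add: power2_eq_square)
    also have "D * (1 / x + 1 / (x - 1) + 1 / (Y - x)) = 2 * x - 1 + D / (Y - x)"
      using nz nz' unfolding D_def by (simp add: distrib_left)
    also have "D / (Y - x) = \<kappa> - (x + Y - 1)" using nz' D by simp
    finally have 1: "D^2 * ((1 / x + 1 / (x - 1) + 1 / (Y - x)) * Z) = (2 * x - 1 + (\<kappa> - (x + Y - 1))) * (D * Z)" .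
    have "R * (D / (Y - x)^2) = q * (\<kappa> - (x + Y - 1))" unfolding R D using nz' by (simp add: power2_eq_square)
    moreover have "D^2 * ((1/2) * (Y * (Y - 1) * (Y - x) / (x^2 * (x - 1)^2)) * (9 + x * (x - 1) / (Y - x)^2))
       = (1/2) * (9 * R + R * (D / (Y - x)^2))"
      using nz nz' unfolding R_def[symmetric] D_def[symmetric] power_mult_distrib[symmetric]
      using D0 by (simp add: algebra_simps)
    ultimately have 2: "D^2 * ((1/2) * (Y * (Y - 1) * (Y - x) / (x^2 * (x - 1)^2)) * (9 + x * (x - 1) / (Y - x)^2))
       = (1/2) * (9 * R + q * (\<kappa> - (x + Y - 1)))" by simp
    have "d * (1/2 * i * z - u + v) = (1/2) * (i * (d * z)) - d * u + d * v" for d z u v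
      by (simp add: algebra_simps)
    then show ?thesis
      unfolding eq i_def[symmetric] by (simp only: 1 2 power_mult_distrib)
  qed
  have "i * (D * Z)^2 = 4 * s * R * p^2 + 4 * s * q * p + (2 * Y - 1 + \<kappa>) * q"
    unfolding DZ' iR[symmetric] iq[symmetric] by (simp add: algebra_simps power2_eq_square)
  note Y2 = Y2[unfolded this]
  have "D * A' = (1/2) * (D^2 * Y2 + (D * Z) * (2 * x - 2 * Y))"
    unfolding A' D_def by (simp add: field_simps power2_eq_square)
  also have "\<dots> = s * R * p^2 + (x + Y - 1) * (R * p) + 2 * R"
    unfolding Y2 DZ' s R q by (simp add: field_simps power2_eq_square)
  finally have DA: "D * A' = s * R * p^2 + (x + Y - 1) * (R * p) + 2 * R" .
  have ZR: "(Z * (Y - 1) * (Y - x) + Y * Z * (Y - x) + Y * (Y - 1) * (Z - 1)) = Z * s - q"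
    unfolding s_def q_def by algebra
  have "D * (A' - p * (Z * s - q)) = R * (2 + (1 - 2 * Y) * p - s * p^2)"
  proof -
    have "D * (A' - p * (Z * s - q)) = D * A' - p * ((D * Z) * s - D * q)" by (simp add: algebra_simps)
    also have "\<dots> = R * (2 + (1 - 2 * Y) * p - s * p^2)"
      unfolding DA DZ' unfolding s R D q by (simp add: algebra_simps power2_eq_square)
    finally show ?thesis .
  qed
  then show "(A' - p * (Z * (Y - 1) * (Y - x) + Y * Z * (Y - x) + Y * (Y - 1) * (Z - 1))) / (Y * (Y - 1) * (Y - x))
       = (2 + (1 - 2 * Y) * p - (3 * Y^2 - 2 * (1 + x) * Y + x) * p^2) / (x * (x - 1))"
    using D0 R0 unfolding ZR D_def[symmetric] R_def[symmetric] s_def[symmetric]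
    by (simp add: divide_eq_eq eq_divide_eq mult.commute)
qed

text \<open>The momentum \<open>p\<close> turns \<open>PVI\<^sub>\<mu>\<close> with \<open>\<mu> = -1\<close> into a system whose right-hand sides are polynomial in
  \<open>y\<close> and \<open>p\<close>; the brackets in \<open>\<Omega>\<^sub>1\<close>, \<open>\<Omega>\<^sub>2\<close>, \<open>\<Omega>\<^sub>3\<close> become affine in \<open>p\<close>.\<close>

lemma PVI_Hamiltonian_system:
  assumes V: "open V" "x \<in> V" and y: "PVI_solution (-1) y V"
    and p: "p = (\<lambda>x. A_fun y x / (y x * (y x - 1) * (y x - x)))"
  shows "(y has_field_derivative (2 * (y x * (y x - 1) * (y x - x)) * p x + y x * (y x - 1)) / (x * (x - 1))) (at x)"
    and "(p has_field_derivative (2 + (1 - 2 * y x) * p x - (3 * (y x)^2 - 2 * (1 + x) * y x + x) * (p x)^2)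
       / (x * (x - 1))) (at x)"
proof -
  have hol: "y holomorphic_on V" using y by (auto simp: PVI_solution_def)
  have nz: "x \<noteq> 0" "x \<noteq> 1" "y x \<noteq> 0" "y x \<noteq> 1" "y x \<noteq> x"
    and eq: "deriv (deriv y) x =
        (1/2) * (1 / y x + 1 / (y x - 1) + 1 / (y x - x)) * (deriv y x)^2
        - (1 / x + 1 / (x - 1) + 1 / (y x - x)) * deriv y x
        + (1/2) * (y x * (y x - 1) * (y x - x) / (x^2 * (x - 1)^2))
            * (9 + x * (x - 1) / (y x - x)^2)"
    using y V by (auto simp: PVI_solution_def)
  have dy: "(y has_field_derivative deriv y x) (at x)"
    by (rule holomorphic_derivI[OF hol V])
  have dy2: "(deriv y has_field_derivative deriv (deriv y) x) (at x)"
    by (rule holomorphic_derivI[OF holomorphic_deriv[OF hol V(1)] V])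
  let ?A' = "(1/2) * ((deriv (deriv y) x * x + deriv y x) * (x - 1) + deriv y x * x - (deriv y x * (y x - 1) + y x * deriv y x))"
  let ?R = "y x * (y x - 1) * (y x - x)"
  have dA: "(A_fun y has_field_derivative ?A') (at x)"
    unfolding A_fun_def[abs_def] by (rule derivative_eq_intros dy dy2 refl | simp)+
  note sys = PVI_Hamiltonian_identities[OF nz eq A_fun_def, of "p x" ?A']
  show "(y has_field_derivative (2 * ?R * p x + y x * (y x - 1)) / (x * (x - 1))) (at x)"
    using sys(1) dy by (simp add: p)
  have "(p has_field_derivative
     (?A' * ?R - A_fun y x * (deriv y x * (y x - 1) * (y x - x) + y x * deriv y x * (y x - x) + y x * (y x - 1) * (deriv y x - 1))) / ?R^2) (at x)"
  proof -
    have "((\<lambda>x. y x * (y x - 1) * (y x - x)) has_field_derivative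
        deriv y x * (y x - 1) * (y x - x) + y x * deriv y x * (y x - x) + y x * (y x - 1) * (deriv y x - 1)) (at x)"
      by (rule derivative_eq_intros dy refl | simp add: algebra_simps)+
    from DERIV_divide[OF dA this] show ?thesis
      using nz by (simp add: p power2_eq_square)
  qed
  also have "A_fun y x = p x * ?R" using nz by (simp add: p)
  also have "(?A' * ?R - p x * ?R * (deriv y x * (y x - 1) * (y x - x) + y x * deriv y x * (y x - x) + y x * (y x - 1) * (deriv y x - 1))) / ?R^2
    = (?A' - p x * (deriv y x * (y x - 1) * (y x - x) + y x * deriv y x * (y x - x) + y x * (y x - 1) * (deriv y x - 1))) / ?R"
      proof -
    have "(a * r - q * r * s) / r^2 = (a - q * s) / r" if "r \<noteq> 0" for a r q s :: complex
      using that by (simp add: field_simps power2_eq_square)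
    then show ?thesis by this (use nz in simp)
  qed
  finally show "(p has_field_derivative (2 + (1 - 2 * y x) * p x - (3 * (y x)^2 - 2 * (1 + x) * y x + x) * (p x)^2)
       / (x * (x - 1))) (at x)"
    using sys(2) by (simp add: p)
qed

section \<open>The functions Omega_i as an Euler top\<close>

lemma Omega_Hamiltonian_variables:
  assumes nz: "y x \<noteq> 0" "y x \<noteq> 1" "y x \<noteq> x"
    and p: "p = (\<lambda>x. A_fun y x / (y x * (y x - 1) * (y x - x)))"
  shows "Omega1 (-1) y sy1 syx sx x = \<i> * (sy1 x * syx x / sx x) * (y x * p x - 1)"
    and "Omega2 (-1) y sy syx s1x x = \<i> * (sy x * syx x / s1x x) * ((y x - 1) * p x - 1)"
    and "Omega3 (-1) y sy sy1 sx s1x x = - (sy x * sy1 x / (sx x * s1x x)) * ((y x - x) * p x - 1)"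
  using nz by (auto simp: Omega1_def Omega2_def Omega3_def p)

text \<open>Derivatives of products and quotients of roots are kept as the function times a
  logarithmic derivative: the roots then stay outside as one common factor, and the remaining
  identity is rational in \<open>x\<close>, \<open>y\<close> and \<open>p\<close>.\<close>

lemma log_derivative_mult:
  fixes f g :: "complex \<Rightarrow> complex"
  assumes "(f has_field_derivative f x * a) (at x)" "(g has_field_derivative g x * b) (at x)"
  shows "((\<lambda>z. f z * g z) has_field_derivative f x * g x * (a + b)) (at x)"
  using DERIV_mult[OF assms] by (simp add: algebra_simps)

lemma log_derivative_divide:
  fixes f g :: "complex \<Rightarrow> complex"
  assumes "(f has_field_derivative f x * a) (at x)" "(g has_field_derivative g x * b) (at x)" "g x \<noteq> 0"
  shows "((\<lambda>z. f z / g z) has_field_derivative f x / g x * (a - b)) (at x)"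
proof -
  have "(f x * a * g x - f x * (g x * b)) / (g x * g x) = f x / g x * (a - b)"
    using assms(3) by (simp add: field_simps)
  with DERIV_divide[OF assms] show ?thesis by simp
qed

text \<open>Each Omega_i is a root factor \<open>\<sigma>i\<close> times a bracket \<open>Bi\<close>
  affine in \<open>P\<close>. By Hamilton's equations, \<open>x (x - 1)\<close> times the derivative
  of such a product, with the root factor taken out, is a quadratic in \<open>P\<close> that factors
  into the other two brackets and one of \<open>Y\<close>, \<open>Y - 1\<close>,
  \<open>Y - x\<close>; the relations between the root factors convert this into the product of the
  other two Omegas. The level -1 is \<open>- \<mu>^2\<close>: in the sum of squares all terms
  containing \<open>P\<close> cancel.\<close>

lemma Omega_system:
  assumes V: "open V" "x \<in> V" and y: "PVI_solution (-1) y V"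
    and roots: "sqrt_branch sx (\<lambda>x. x) V" "sqrt_branch s1x (\<lambda>x. 1 - x) V"
      "sqrt_branch sy y V" "sqrt_branch sy1 (\<lambda>x. y x - 1) V" "sqrt_branch syx (\<lambda>x. y x - x) V"
  defines "O1 \<equiv> Omega1 (-1) y sy1 syx sx" and "O2 \<equiv> Omega2 (-1) y sy syx s1x"
    and "O3 \<equiv> Omega3 (-1) y sy sy1 sx s1x"
  shows "(O1 has_field_derivative O2 x * O3 x / x) (at x)"
    and "(O2 has_field_derivative O1 x * O3 x / (1 - x)) (at x)"
    and "(O3 has_field_derivative O1 x * O2 x / (x * (x - 1))) (at x)"
    and "(O1 x)^2 + (O2 x)^2 + (O3 x)^2 = -1"
proof -
  define p where "p = (\<lambda>x. A_fun y x / (y x * (y x - 1) * (y x - x)))"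
  have nzV: "z \<noteq> 0" "z \<noteq> 1" "y z \<noteq> 0" "y z \<noteq> 1" "y z \<noteq> z" if "z \<in> V" for z
    using y that by (auto simp: PVI_solution_def)
  note nz = nzV[OF V(2)]
  note O = Omega_Hamiltonian_variables[OF nzV(3-5) p_def]
  define Y P where "Y = y x" and "P = p x"
  define D Y' P' where "D = x * (x - 1)"
    and "Y' = (2 * (Y * (Y - 1) * (Y - x)) * P + Y * (Y - 1)) / D"
    and "P' = (2 + (1 - 2 * Y) * P - (3 * Y^2 - 2 * (1 + x) * Y + x) * P^2) / D"
  note ham = PVI_Hamiltonian_system[OF V y p_def]
  have dy: "(y has_field_derivative Y') (at x)" and dp: "(p has_field_derivative P') (at x)"
    using ham by (simp_all add: Y'_def P'_def Y_def P_def D_def)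
  have D0: "D \<noteq> 0" using nz by (simp add: D_def)
  have DY: "D * Y' = 2 * (Y * (Y - 1) * (Y - x)) * P + Y * (Y - 1)"
    and DP: "D * P' = 2 + (1 - 2 * Y) * P - (3 * Y^2 - 2 * (1 + x) * Y + x) * P^2"
    using D0 by (simp_all add: Y'_def P'_def)
  have nz': "Y \<noteq> 0" "Y - 1 \<noteq> 0" "Y - x \<noteq> 0" "x \<noteq> 0" "x - 1 \<noteq> 0" "1 - x \<noteq> 0" using nz by (auto simp: Y_def)
  have dx: "((\<lambda>x. x) has_field_derivative 1) (at x)" "((\<lambda>x. 1 - x) has_field_derivative -1) (at x)"
    "((\<lambda>x. y x - 1) has_field_derivative Y') (at x)" "((\<lambda>x. y x - x) has_field_derivative Y' - 1) (at x)"
    by (rule derivative_eq_intros dy refl | simp)+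
  define \<alpha>0 \<alpha>1 \<alpha>x \<beta>0 \<beta>1 where "\<alpha>0 = Y' / (2 * Y)" and "\<alpha>1 = Y' / (2 * (Y - 1))"
    and "\<alpha>x = (Y' - 1) / (2 * (Y - x))" and "\<beta>0 = 1 / (2 * x)" and "\<beta>1 = - 1 / (2 * (1 - x))"
  note defs = \<alpha>0_def \<alpha>1_def \<alpha>x_def \<beta>0_def \<beta>1_def
  have dsx: "(sx has_field_derivative sx x * \<beta>0) (at x)" "sx x \<noteq> 0" "sx x * sx x = x"
    using sqrt_branch_has_field_derivative[OF roots(1) V dx(1)] nz roots(1) V
    by (auto simp: sqrt_branch_def defs power2_eq_square)
  have ds1x: "(s1x has_field_derivative s1x x * \<beta>1) (at x)" "s1x x \<noteq> 0" "s1x x * s1x x = 1 - x"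
    using sqrt_branch_has_field_derivative[OF roots(2) V dx(2)] nz roots(2) V
    by (auto simp: sqrt_branch_def defs power2_eq_square)
  have dsy: "(sy has_field_derivative sy x * \<alpha>0) (at x)" "sy x * sy x = Y"
    using sqrt_branch_has_field_derivative[OF roots(3) V dy] nz roots(3) V
    by (auto simp: sqrt_branch_def Y_def defs power2_eq_square)
  have dsy1: "(sy1 has_field_derivative sy1 x * \<alpha>1) (at x)" "sy1 x * sy1 x = Y - 1"
    using sqrt_branch_has_field_derivative[OF roots(4) V dx(3)] nz roots(4) V
    by (auto simp: sqrt_branch_def Y_def defs power2_eq_square)
  have dsyx: "(syx has_field_derivative syx x * \<alpha>x) (at x)" "syx x * syx x = Y - x"
    using sqrt_branch_has_field_derivative[OF roots(5) V dx(4)] nz roots(5) V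
    by (auto simp: sqrt_branch_def Y_def defs power2_eq_square)
  have D\<alpha>0: "D * \<alpha>0 = (Y - 1) * (Y - x) * P + (Y - 1) / 2"
    and D\<alpha>1: "D * \<alpha>1 = Y * (Y - x) * P + Y / 2"
    unfolding \<alpha>0_def \<alpha>1_def times_divide_eq_right DY using nz' by (auto simp: divide_eq_eq) algebra+
  have "D * (Y' - 1) = 2 * (Y - x) * (Y * (Y - 1) * P + (Y + x - 1) / 2)"
    unfolding right_diff_distrib DY unfolding D_def by (simp add: field_simps)
  then have D\<alpha>x: "D * \<alpha>x = Y * (Y - 1) * P + (Y + x - 1) / 2"
    unfolding \<alpha>x_def times_divide_eq_right using nz' by simp
  have D\<beta>0: "D * \<beta>0 = (x - 1) / 2" using nz' by (simp add: D_def defs)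
  have D\<beta>1: "D * \<beta>1 = x / 2" using nz' by (simp add: D_def defs field_simps)
  define B1 B2 B3 where "B1 = Y * P - 1" and "B2 = (Y - 1) * P - 1" and "B3 = (Y - x) * P - 1"
  define \<sigma>1 \<sigma>2 \<sigma>3 where "\<sigma>1 = sy1 x * syx x / sx x" and "\<sigma>2 = sy x * syx x / s1x x"
    and "\<sigma>3 = sy x * sy1 x / (sx x * s1x x)"
  have O_x: "O1 x = \<i> * \<sigma>1 * B1" "O2 x = \<i> * \<sigma>2 * B2" "O3 x = - \<sigma>3 * B3"
    by (simp_all add: O1_def O2_def O3_def O[OF V(2) V(2) V(2)] \<sigma>1_def \<sigma>2_def \<sigma>3_def B1_def B2_def B3_def Y_def P_def)
  have dPY: "((\<lambda>x. y x * p x - 1) has_field_derivative Y' * P + Y * P') (at x)"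
     "((\<lambda>x. (y x - 1) * p x - 1) has_field_derivative Y' * P + (Y - 1) * P') (at x)"
     "((\<lambda>x. (y x - x) * p x - 1) has_field_derivative (Y' - 1) * P + (Y - x) * P') (at x)"
    by (rule derivative_eq_intros dy dp refl | simp add: Y_def P_def)+
  \<comment> \<open>In a product of two root factors the repeated root becomes a square and the
    other roots reassemble into the third factor. No sign ambiguity arises, since the same branch of
    each root enters all three.\<close>
  have \<sigma>\<sigma>: "\<sigma>2 * \<sigma>3 * (1 - x) = \<sigma>1 * Y" "\<sigma>1 * \<sigma>3 * x = \<sigma>2 * (Y - 1)" "\<sigma>1 * \<sigma>2 = \<sigma>3 * (Y - x)"
  proof -
    have 1: "(a * d / q) * (a * b / (r * q)) * (q * q) = (b * d / r) * (a * a)"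
      and 2: "(b * d / r) * (a * b / (r * q)) * (r * r) = (a * d / q) * (b * b)"
      and 3: "(b * d / r) * (a * d / q) = (a * b / (r * q)) * (d * d)"
      if "q \<noteq> 0" "r \<noteq> 0" for a b d q r :: complex
      using that by (simp_all add: field_simps)
    show "\<sigma>2 * \<sigma>3 * (1 - x) = \<sigma>1 * Y" "\<sigma>1 * \<sigma>3 * x = \<sigma>2 * (Y - 1)" "\<sigma>1 * \<sigma>2 = \<sigma>3 * (Y - x)"
      using 1[OF ds1x(2) dsx(2), of "sy x" "syx x" "sy1 x"] 2[OF ds1x(2) dsx(2), of "sy1 x" "syx x" "sy x"]
        3[OF ds1x(2) dsx(2), of "sy1 x" "syx x" "sy x"]
      unfolding dsx(3) ds1x(3) dsy(2) dsy1(2) dsyx(2) \<sigma>1_def \<sigma>2_def \<sigma>3_def .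
  qed
  \<comment> \<open>Derivatives are compared after multiplication by \<open>D = x (x - 1)\<close>,
    the form in which Hamilton's equations and the logarithmic derivatives have no
    denominators.\<close>
  have transfer: "(f has_field_derivative r) (at x)"
    if "(g has_field_derivative d) (at x)" "\<And>z. z \<in> V \<Longrightarrow> g z = f z" "D * d = D * r" for f g d r
    using has_field_derivative_transform_within_open[OF that(1) V that(2)] that(3) D0 by simp
  show "(O1 has_field_derivative O2 x * O3 x / x) (at x)"
  proof (rule transfer)
    show "((\<lambda>z. \<i> * (sy1 z * syx z / sx z) * (y z * p z - 1)) has_field_derivative
       \<i> * \<sigma>1 * ((\<alpha>1 + \<alpha>x - \<beta>0) * B1 + (Y' * P + Y * P'))) (at x)"
      by (rule DERIV_cong[OF DERIV_mult[OF DERIV_cmult[OF log_derivative_divide[OF log_derivative_mult[OF dsy1(1) dsyx(1)] dsx(1,2)], of \<i>] dPY(1)]])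
        (simp only: \<sigma>1_def[symmetric] B1_def Y_def P_def, simp add: algebra_simps)
    have "D * ((\<alpha>1 + \<alpha>x - \<beta>0) * B1 + (Y' * P + Y * P'))
       = (D * \<alpha>1 + D * \<alpha>x - D * \<beta>0) * B1 + (D * Y' * P + Y * (D * P'))" by (simp add: algebra_simps)
    also have "\<dots> = Y * B2 * B3"
      unfolding D\<alpha>0 D\<alpha>1 D\<alpha>x D\<beta>0 D\<beta>1 DY DP B1_def B2_def B3_def by (simp add: field_simps power2_eq_square)
    finally have 1: "D * ((\<alpha>1 + \<alpha>x - \<beta>0) * B1 + (Y' * P + Y * P')) = Y * B2 * B3" .
    have "D * (\<i> * \<sigma>1 * ((\<alpha>1 + \<alpha>x - \<beta>0) * B1 + (Y' * P + Y * P'))) = \<i> * (\<sigma>1 * Y) * B2 * B3"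
      using arg_cong[OF 1, of "\<lambda>z. \<i> * \<sigma>1 * z"] by (simp only: mult_ac)
    also have "\<dots> = D * (O2 x * O3 x / x)"
      unfolding \<sigma>\<sigma>(1)[symmetric] O_x D_def using nz' by (simp add: field_simps)
    finally show "D * (\<i> * \<sigma>1 * ((\<alpha>1 + \<alpha>x - \<beta>0) * B1 + (Y' * P + Y * P'))) = D * (O2 x * O3 x / x)" .
  qed (simp add: O1_def O)
  show "(O2 has_field_derivative O1 x * O3 x / (1 - x)) (at x)"
  proof (rule transfer)
    show "((\<lambda>z. \<i> * (sy z * syx z / s1x z) * ((y z - 1) * p z - 1)) has_field_derivative
       \<i> * \<sigma>2 * ((\<alpha>0 + \<alpha>x - \<beta>1) * B2 + (Y' * P + (Y - 1) * P'))) (at x)"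
      by (rule DERIV_cong[OF DERIV_mult[OF DERIV_cmult[OF log_derivative_divide[OF log_derivative_mult[OF dsy(1) dsyx(1)] ds1x(1,2)], of \<i>] dPY(2)]])
        (simp only: \<sigma>2_def[symmetric] B2_def Y_def P_def, simp add: algebra_simps)
    have "D * ((\<alpha>0 + \<alpha>x - \<beta>1) * B2 + (Y' * P + (Y - 1) * P'))
       = (D * \<alpha>0 + D * \<alpha>x - D * \<beta>1) * B2 + (D * Y' * P + (Y - 1) * (D * P'))" by (simp add: algebra_simps)
    also have "\<dots> = (Y - 1) * B1 * B3"
      unfolding D\<alpha>0 D\<alpha>1 D\<alpha>x D\<beta>0 D\<beta>1 DY DP B1_def B2_def B3_def by (simp add: field_simps power2_eq_square)
    finally have 1: "D * ((\<alpha>0 + \<alpha>x - \<beta>1) * B2 + (Y' * P + (Y - 1) * P')) = (Y - 1) * B1 * B3" .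
    have "D * (\<i> * \<sigma>2 * ((\<alpha>0 + \<alpha>x - \<beta>1) * B2 + (Y' * P + (Y - 1) * P'))) = \<i> * (\<sigma>2 * (Y - 1)) * B1 * B3"
      using arg_cong[OF 1, of "\<lambda>z. \<i> * \<sigma>2 * z"] by (simp only: mult_ac)
    also have "\<dots> = D * (O1 x * O3 x / (1 - x))"
      unfolding \<sigma>\<sigma>(2)[symmetric] O_x D_def using nz' by (simp add: field_simps)
    finally show "D * (\<i> * \<sigma>2 * ((\<alpha>0 + \<alpha>x - \<beta>1) * B2 + (Y' * P + (Y - 1) * P'))) = D * (O1 x * O3 x / (1 - x))" .
  qed (simp add: O2_def O)
  show "(O3 has_field_derivative O1 x * O2 x / (x * (x - 1))) (at x)"
  proof (rule transfer)
    show "((\<lambda>z. - 1 * (sy z * sy1 z / (sx z * s1x z)) * ((y z - z) * p z - 1)) has_field_derivative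
       - 1 * \<sigma>3 * ((\<alpha>0 + \<alpha>1 - (\<beta>0 + \<beta>1)) * B3 + ((Y' - 1) * P + (Y - x) * P'))) (at x)"
      by (rule DERIV_cong[OF DERIV_mult[OF DERIV_cmult[OF log_derivative_divide[OF log_derivative_mult[OF dsy(1) dsy1(1)] log_derivative_mult[OF dsx(1) ds1x(1)]], of "-1"] dPY(3)]])
        (use dsx(2) ds1x(2) in simp, simp only: \<sigma>3_def[symmetric] B3_def Y_def P_def, simp add: algebra_simps)
    have "D * ((\<alpha>0 + \<alpha>1 - (\<beta>0 + \<beta>1)) * B3 + ((Y' - 1) * P + (Y - x) * P'))
       = (D * \<alpha>0 + D * \<alpha>1 - D * \<beta>0 - D * \<beta>1) * B3 + ((D * Y' - D) * P + (Y - x) * (D * P'))" by (simp add: algebra_simps)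
    also have "\<dots> = (Y - x) * B1 * B2"
      unfolding D\<alpha>0 D\<alpha>1 D\<alpha>x D\<beta>0 D\<beta>1 DY DP unfolding B1_def B2_def B3_def D_def by (simp add: field_simps power2_eq_square)
    finally have 1: "D * ((\<alpha>0 + \<alpha>1 - (\<beta>0 + \<beta>1)) * B3 + ((Y' - 1) * P + (Y - x) * P')) = (Y - x) * B1 * B2" .
    have "D * (- 1 * \<sigma>3 * ((\<alpha>0 + \<alpha>1 - (\<beta>0 + \<beta>1)) * B3 + ((Y' - 1) * P + (Y - x) * P'))) = - 1 * (\<sigma>3 * (Y - x)) * B1 * B2"
      using arg_cong[OF 1, of "\<lambda>z. - 1 * \<sigma>3 * z"] by (simp only: mult_ac)
    also have "\<dots> = (\<i> * \<i>) * ((\<sigma>1 * B1) * (\<sigma>2 * B2))" by (simp add: \<sigma>\<sigma>(3)[symmetric])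
    also have "\<dots> = O1 x * O2 x" unfolding O_x by (simp only: mult_ac)
    also have "\<dots> = D * (O1 x * O2 x / (x * (x - 1)))"
      unfolding D_def using nz' by simp
    finally show "D * (- 1 * \<sigma>3 * ((\<alpha>0 + \<alpha>1 - (\<beta>0 + \<beta>1)) * B3 + ((Y' - 1) * P + (Y - x) * P'))) = D * (O1 x * O2 x / (x * (x - 1)))" .
  qed (simp add: O3_def O)
  have \<sigma>2: "x * \<sigma>1^2 = (Y - 1) * (Y - x)" "(1 - x) * \<sigma>2^2 = Y * (Y - x)" "x * (1 - x) * \<sigma>3^2 = Y * (Y - 1)"
  proof -
    have 1: "(q * q) * (a * b / q)^2 = (a * a) * (b * b)"
      and 2: "(q * q) * (r * r) * (a * b / (q * r))^2 = (a * a) * (b * b)"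
      if "q \<noteq> 0" "r \<noteq> 0" for a b q r :: complex
      using that by (simp_all add: field_simps power2_eq_square)
    show "x * \<sigma>1^2 = (Y - 1) * (Y - x)" "(1 - x) * \<sigma>2^2 = Y * (Y - x)" "x * (1 - x) * \<sigma>3^2 = Y * (Y - 1)"
      using 1[OF dsx(2) ds1x(2), of "sy1 x" "syx x"] 1[OF ds1x(2) dsx(2), of "sy x" "syx x"]
        2[OF dsx(2) ds1x(2), of "sy x" "sy1 x"]
      unfolding dsx(3) ds1x(3) dsy(2) dsy1(2) dsyx(2) \<sigma>1_def \<sigma>2_def \<sigma>3_def .
  qed
  have "D * ((O1 x)^2 + (O2 x)^2 + (O3 x)^2)
    = - (x - 1) * (x * \<sigma>1^2) * B1^2 + x * ((1 - x) * \<sigma>2^2) * B2^2 - (x * (1 - x) * \<sigma>3^2) * B3^2"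
    unfolding O_x D_def by (simp add: power_mult_distrib algebra_simps)
  also have "\<dots> = D * (- 1)"
    unfolding \<sigma>2 B1_def B2_def B3_def D_def by (simp add: algebra_simps power2_eq_square)
  finally show "(O1 x)^2 + (O2 x)^2 + (O3 x)^2 = -1"
    using D0 by (simp only: mult_cancel_left) simp
qed

section \<open>The orthonormal frame\<close>

text \<open>With \<open>w\<close> a unit vector, \<open>v \<mapsto> v \<times> w\<close> is skew
  with eigenvalues \<open>\<i>\<close>, 0, \<open>-\<i>\<close>; \<open>e\<close>, \<open>w\<close>
  and \<open>(g1, 1, g3)\<close> are eigenvectors in this order, and \<open>cross\<close> records
  three components of this. Skewness makes \<open>e\<close> and \<open>g\<close> isotropic and
  orthogonal to \<open>w\<close>; the scaling is chosen so that \<open>e\<close> and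
  \<open>g\<close> pair to 1. The row identities say the same for the inverse matrix.\<close>

lemma frame_identities:
  fixes w1 w2 w3 e1 e2 e3 g1 g3 :: complex
  assumes norm: "w1^2 + w2^2 + w3^2 = 1"
    and e: "2 * e1 = - (w1 * w2 + \<i> * w3)" "2 * e2 = w1^2 + w3^2" "2 * e3 = \<i> * w1 - w2 * w3"
    and g: "2 * e2 * g1 = \<i> * w3 - w1 * w2" "2 * e2 * g3 = - (\<i> * w1 + w2 * w3)"
    and nz: "e2 \<noteq> 0"
  shows cross: "e1 * w2 - e2 * w1 = \<i> * e3" "e2 * w3 - e3 * w2 = \<i> * e1" "g1 * w2 - w1 = - \<i> * g3"
    and columns: "e1^2 + e2^2 + e3^2 = 0" "e1 * w1 + e2 * w2 + e3 * w3 = 0" "e1 * g1 + e2 + e3 * g3 = 1"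
      "w1 * g1 + w2 + w3 * g3 = 0" "g1^2 + 1 + g3^2 = 0"
    and rows: "2 * e1 * g1 + w1^2 = 1" "2 * e2 + w2^2 = 1" "2 * e3 * g3 + w3^2 = 1"
      "e1 + w1 * w2 + g1 * e2 = 0" "e1 * g3 + w1 * w3 + g1 * e3 = 0" "e2 * g3 + w2 * w3 + e3 = 0"
proof -
  \<comment> \<open>The equations for \<open>g1\<close> and \<open>g3\<close> determine them only
    after cancelling \<open>e2\<close>. Naming the inverse \<open>h\<close> turns the cancellation
    into the polynomial relation \<open>h * e2 = 1\<close>; likewise \<open>j\<close> supplies the
    relation for \<open>\<i>\<close>, which is otherwise treated as an indeterminate.\<close>
  define h where "h = inverse e2"
  have h: "h * e2 = 1" using nz by (simp add: h_def)
  have j: "\<i> * \<i> = -1" by simp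
  show "e1 * w2 - e2 * w1 = \<i> * e3" "e2 * w3 - e3 * w2 = \<i> * e1" "e1^2 + e2^2 + e3^2 = 0"
    "e1 * w1 + e2 * w2 + e3 * w3 = 0" "2 * e2 + w2^2 = 1"
    using e norm j by algebra+
  show "g1 * w2 - w1 = - \<i> * g3" "e1 * g1 + e2 + e3 * g3 = 1"
    "w1 * g1 + w2 + w3 * g3 = 0" "g1^2 + 1 + g3^2 = 0" "2 * e1 * g1 + w1^2 = 1" "2 * e3 * g3 + w3^2 = 1"
    "e1 + w1 * w2 + g1 * e2 = 0" "e1 * g3 + w1 * w3 + g1 * e3 = 0" "e2 * g3 + w2 * w3 + e3 = 0"
    using e g norm j h by algebra+
qed

text \<open>This is what remains of the Painleve solution once \<open>y\<close> and the roots are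
  gone. The entries of the first and third columns are characterised by products rather than
  quotients, and the integrand of \<open>T\<close> appears as \<open>E31 E32 / b\<close>, which is
  also defined where \<open>E32\<close> vanishes.\<close>

locale PVI_frame =
  fixes E :: "complex \<Rightarrow> complex^3^3" and T :: "complex \<Rightarrow> complex" and R :: "complex set"
  assumes open_R: "open R" and R01: "0 \<notin> R" "1 \<notin> R"
    and dw: "\<And>x. x \<in> R \<Longrightarrow> ((\<lambda>x. E x $ 1 $ 2) has_field_derivative - \<i> * E x $ 2 $ 2 * E x $ 3 $ 2 / x) (at x)"
      "\<And>x. x \<in> R \<Longrightarrow> ((\<lambda>x. E x $ 2 $ 2) has_field_derivative - \<i> * E x $ 1 $ 2 * E x $ 3 $ 2 / (1 - x)) (at x)"
      "\<And>x. x \<in> R \<Longrightarrow> ((\<lambda>x. E x $ 3 $ 2) has_field_derivative \<i> * E x $ 1 $ 2 * E x $ 2 $ 2 / (x * (1 - x))) (at x)"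
    and norm: "\<And>x. x \<in> R \<Longrightarrow> (E x $ 1 $ 2)^2 + (E x $ 2 $ 2)^2 + (E x $ 3 $ 2)^2 = 1"
    and e: "\<And>x. x \<in> R \<Longrightarrow> 2 * E x $ 1 $ 1 = - (E x $ 1 $ 2 * E x $ 2 $ 2 + \<i> * E x $ 3 $ 2)"
      "\<And>x. x \<in> R \<Longrightarrow> 2 * E x $ 2 $ 1 = (E x $ 1 $ 2)^2 + (E x $ 3 $ 2)^2"
      "\<And>x. x \<in> R \<Longrightarrow> 2 * E x $ 3 $ 1 = \<i> * E x $ 1 $ 2 - E x $ 2 $ 2 * E x $ 3 $ 2"
    and g: "\<And>x. x \<in> R \<Longrightarrow> 2 * E x $ 2 $ 1 * E x $ 1 $ 3 = \<i> * E x $ 3 $ 2 - E x $ 1 $ 2 * E x $ 2 $ 2"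
      "\<And>x. x \<in> R \<Longrightarrow> E x $ 2 $ 3 = 1"
      "\<And>x. x \<in> R \<Longrightarrow> 2 * E x $ 2 $ 1 * E x $ 3 $ 3 = - (\<i> * E x $ 1 $ 2 + E x $ 2 $ 2 * E x $ 3 $ 2)"
    and nz: "\<And>x. x \<in> R \<Longrightarrow> E x $ 1 $ 1 \<noteq> 0" "\<And>x. x \<in> R \<Longrightarrow> E x $ 2 $ 1 \<noteq> 0" "\<And>x. x \<in> R \<Longrightarrow> E x $ 3 $ 1 \<noteq> 0"
      "\<And>x. x \<in> R \<Longrightarrow> b_fun E x \<noteq> 0"
    and dT: "\<And>x. x \<in> R \<Longrightarrow> (T has_field_derivative E x $ 3 $ 1 * E x $ 3 $ 2 / b_fun E x) (at x)"
begin

abbreviation w1 where "w1 x \<equiv> E x $ 1 $ 2"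
abbreviation w2 where "w2 x \<equiv> E x $ 2 $ 2"
abbreviation w3 where "w3 x \<equiv> E x $ 3 $ 2"
abbreviation e1 where "e1 x \<equiv> E x $ 1 $ 1"
abbreviation e2 where "e2 x \<equiv> E x $ 2 $ 1"
abbreviation e3 where "e3 x \<equiv> E x $ 3 $ 1"
abbreviation g1 where "g1 x \<equiv> E x $ 1 $ 3"
abbreviation g3 where "g3 x \<equiv> E x $ 3 $ 3"

lemmas identities = frame_identities[OF norm e g(1) g(3) nz(2)]

text \<open>The frame is normalised by \<open>E\<^sub>2\<^sub>3 = 1\<close>; the columns \<open>E\<^sub>i\<^sub>1 / k\<close>, \<open>E\<^sub>i\<^sub>2\<close>, \<open>k E\<^sub>i\<^sub>3\<close> satisfy a common
  linear system with skew-symmetric matrix exactly when \<open>k' / k = rho\<close>. Since \<open>b' = rho b\<close>, one may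
  take \<open>k\<close> proportional to \<open>b\<close>, which is where \<open>f = H b / 3\<close> comes from.\<close>

definition rho where "rho x = - \<i> * w1 x * g3 x / (1 - x)"

text \<open>The value of \<open>rho\<close> is forced by the second row: since \<open>E23\<close> is
  constantly 1, the linear system for the third column scaled by \<open>k\<close> reduces there to
  \<open>k' = - \<i> * w1 * (k * g3) / (1 - x)\<close>.\<close>

lemma deriv_frame:
  assumes x: "x \<in> R"
  shows "(e1 has_field_derivative - \<i> * w2 x * e3 x / x + rho x * e1 x) (at x)" (is ?e1)
    and "(e2 has_field_derivative - \<i> * w1 x * e3 x / (1 - x) + rho x * e2 x) (at x)" (is ?e2)
    and "(e3 has_field_derivative \<i> * w2 x * e1 x / x + \<i> * w1 x * e2 x / (1 - x) + rho x * e3 x) (at x)" (is ?e3)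
    and "(g1 has_field_derivative - \<i> * w2 x * g3 x / x - rho x * g1 x) (at x)" (is ?g1)
    and "(g3 has_field_derivative \<i> * w2 x * g1 x / x + \<i> * w1 x / (1 - x) - rho x * g3 x) (at x)" (is ?g3)
proof -
  \<comment> \<open>By partial fractions \<open>1 / (x * (1 - x)) = m + n\<close>, so with
    \<open>m\<close> and \<open>n\<close> as indeterminates the derivative identities become
    polynomial.\<close>
  define m n where "m = 1 / x" and "n = 1 / (1 - x)"
  have "x \<noteq> 0" "x \<noteq> 1" using x R01 by auto
  then have mn: "m * n = m + n" "1 / (x * (1 - x)) = m + n" by (auto simp: m_def n_def field_simps)
  have "\<i> * w1 x * w2 x / (x * (1 - x)) = \<i> * w1 x * w2 x * (m + n)"
    unfolding mn(2)[symmetric] by simp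
  with dw(3)[OF x] have dw3: "(w3 has_field_derivative \<i> * w1 x * w2 x * (m + n)) (at x)" by simp
  have dw': "(w1 has_field_derivative - \<i> * w2 x * w3 x * m) (at x)"
    "(w2 has_field_derivative - \<i> * w1 x * w3 x * n) (at x)"
    "(w3 has_field_derivative \<i> * w1 x * w2 x * (m + n)) (at x)"
    using dw(1,2)[OF x] dw3 by (simp_all add: m_def n_def)
  have r: "rho x = - \<i> * w1 x * g3 x * n" by (simp add: rho_def n_def)
  have j: "\<i> * \<i> = -1" by simp
  note id = identities[OF x x x x x x x]
  have transfer: "(f has_field_derivative r) (at x)"
    if "(h has_field_derivative d) (at x)" "\<And>z. z \<in> R \<Longrightarrow> h z = f z" "d = r" for f h d r
    using has_field_derivative_transform_within_open[OF that(1) open_R x that(2)] that(3) by simp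
  have half: "(f has_field_derivative r) (at x)"
    if "(h has_field_derivative d) (at x)" "\<And>z. z \<in> R \<Longrightarrow> h z = 2 * f z" "d = 2 * r" for f h d r
    using DERIV_cmult[OF that(1), of "1/2"] by (rule transfer) (use that(2,3) in auto)
  have de1: "(e1 has_field_derivative - \<i> * w2 x * e3 x * m + rho x * e1 x) (at x)"
  proof (rule half)
    show "((\<lambda>x. - (w1 x * w2 x + \<i> * w3 x)) has_field_derivative
       - ((- \<i> * w2 x * w3 x * m) * w2 x + w1 x * (- \<i> * w1 x * w3 x * n) + \<i> * (\<i> * w1 x * w2 x * (m + n))) ) (at x)"
      by (rule DERIV_cong, (rule derivative_eq_intros dw' refl | (simp; fail) | (insert j, algebra))+)
    show "- ((- \<i> * w2 x * w3 x * m) * w2 x + w1 x * (- \<i> * w1 x * w3 x * n) + \<i> * (\<i> * w1 x * w2 x * (m + n))) 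
       = 2 * (- \<i> * w2 x * e3 x * m + rho x * e1 x)"
      using e[OF x] id j unfolding r by algebra
  qed (use e(1) in auto)
  have de2: "(e2 has_field_derivative - \<i> * w1 x * e3 x * n + rho x * e2 x) (at x)"
  proof (rule half)
    show "((\<lambda>x. w1 x * w1 x + w3 x * w3 x) has_field_derivative
       2 * w1 x * (- \<i> * w2 x * w3 x * m) + 2 * w3 x * (\<i> * w1 x * w2 x * (m + n))) (at x)"
      by (rule DERIV_cong, (rule derivative_eq_intros dw' refl | (simp; fail) | (insert j, algebra))+)
    show "2 * w1 x * (- \<i> * w2 x * w3 x * m) + 2 * w3 x * (\<i> * w1 x * w2 x * (m + n))
       = 2 * (- \<i> * w1 x * e3 x * n + rho x * e2 x)"
      using e[OF x] id j unfolding r by algebra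
  qed (use e(2) in \<open>auto simp: power2_eq_square\<close>)
  have de3: "(e3 has_field_derivative \<i> * w2 x * e1 x * m + \<i> * w1 x * e2 x * n + rho x * e3 x) (at x)"
  proof (rule half)
    show "((\<lambda>x. (\<i> * w1 x - w2 x * w3 x)) has_field_derivative
       (\<i> * (- \<i> * w2 x * w3 x * m) - ((- \<i> * w1 x * w3 x * n) * w3 x + w2 x * (\<i> * w1 x * w2 x * (m + n)))) ) (at x)"
      by (rule DERIV_cong, (rule derivative_eq_intros dw' refl | (simp; fail) | (insert j, algebra))+)
    show "(\<i> * (- \<i> * w2 x * w3 x * m) - ((- \<i> * w1 x * w3 x * n) * w3 x + w2 x * (\<i> * w1 x * w2 x * (m + n)))) 
       = 2 * (\<i> * w2 x * e1 x * m + \<i> * w1 x * e2 x * n + rho x * e3 x)"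
      using e[OF x] id j unfolding r by algebra
  qed (use e(3) in auto)
  \<comment> \<open>The third column is known only through its product with \<open>2 * e2\<close>,
    so it is differentiated as the quotient \<open>h / (2 * e2)\<close>; the last premise is the
    product rule that the result must satisfy.\<close>
  have dg: "(f has_field_derivative r) (at x)"
    if "(h has_field_derivative d) (at x)" "\<And>z. z \<in> R \<Longrightarrow> 2 * e2 z * f z = h z"
       "d = 2 * (- \<i> * w1 x * e3 x * n + rho x * e2 x) * f x + 2 * e2 x * r" for f h d r
  proof (rule transfer)
    show "((\<lambda>z. h z / (2 * e2 z)) has_field_derivative
      (d * (2 * e2 x) - h x * (2 * (- \<i> * w1 x * e3 x * n + rho x * e2 x))) / (2 * e2 x * (2 * e2 x))) (at x)"
      by (rule DERIV_divide[OF that(1) DERIV_cmult[OF de2]]) (use nz(2)[OF x] in simp)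
    show "h z / (2 * e2 z) = f z" if "z \<in> R" for z
      using \<open>\<And>z. z \<in> R \<Longrightarrow> 2 * e2 z * f z = h z\<close>[OF that] nz(2)[OF that] by (simp add: divide_eq_eq mult.commute)
    have "h x = 2 * e2 x * f x" using that(2) x by simp
    then show "(d * (2 * e2 x) - h x * (2 * (- \<i> * w1 x * e3 x * n + rho x * e2 x))) / (2 * e2 x * (2 * e2 x)) = r"
      using nz(2)[OF x] unfolding that(3) by (simp add: divide_eq_eq algebra_simps)
  qed
  have dg1: "(g1 has_field_derivative - \<i> * w2 x * g3 x * m - rho x * g1 x) (at x)"
  proof (rule dg)
    show "((\<lambda>x. \<i> * w3 x - w1 x * w2 x) has_field_derivative
       \<i> * (\<i> * w1 x * w2 x * (m + n)) - ((- \<i> * w2 x * w3 x * m) * w2 x + w1 x * (- \<i> * w1 x * w3 x * n))) (at x)"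
      by (rule DERIV_cong, (rule derivative_eq_intros dw' refl | (simp; fail) | (insert j, algebra))+)
    show "\<i> * (\<i> * w1 x * w2 x * (m + n)) - ((- \<i> * w2 x * w3 x * m) * w2 x + w1 x * (- \<i> * w1 x * w3 x * n))
       = 2 * (- \<i> * w1 x * e3 x * n + rho x * e2 x) * g1 x + 2 * e2 x * (- \<i> * w2 x * g3 x * m - rho x * g1 x)"
      using e[OF x] g[OF x] id j unfolding r by algebra
  qed (use g(1) in auto)
  have dg3: "(g3 has_field_derivative \<i> * w2 x * g1 x * m + \<i> * w1 x * n - rho x * g3 x) (at x)"
  proof (rule dg)
    show "((\<lambda>x. - (\<i> * w1 x + w2 x * w3 x)) has_field_derivative
       - (\<i> * (- \<i> * w2 x * w3 x * m) + ((- \<i> * w1 x * w3 x * n) * w3 x + w2 x * (\<i> * w1 x * w2 x * (m + n))))) (at x)"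
      by (rule DERIV_cong, (rule derivative_eq_intros dw' refl | (simp; fail) | (insert j, algebra))+)
    show "- (\<i> * (- \<i> * w2 x * w3 x * m) + ((- \<i> * w1 x * w3 x * n) * w3 x + w2 x * (\<i> * w1 x * w2 x * (m + n))))
       = 2 * (- \<i> * w1 x * e3 x * n + rho x * e2 x) * g3 x
         + 2 * e2 x * (\<i> * w2 x * g1 x * m + \<i> * w1 x * n - rho x * g3 x)"
      using e[OF x] g[OF x] id j unfolding r by algebra
  qed (use g(3) in auto)
  show ?e1 ?e2 ?e3 ?g1 ?g3 using de1 de2 de3 dg1 dg3 by (simp_all add: m_def n_def)
qed

text \<open>Each coefficient pairs two columns \<open>X\<close>, \<open>Y\<close> with the weights
  0, 1, x of the rows. The weights do not commute with the skew matrix of the linear system, and the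
  commutator contributes \<open>\<i>\<close> times third components of \<open>X \<times> w\<close>
  and \<open>Y \<times> w\<close>. If the eigenvalues of \<open>X\<close> and \<open>Y\<close> are
  \<open>\<i> * l\<close> and \<open>\<i> * l'\<close>, the total is
  \<open>(1 - l - l') * X3 * Y3\<close>, apart from the \<open>rho\<close> terms of the
  normalisation. With \<open>l = 1, 0, -1\<close> for the columns this gives the factors 1, 0, 2, 3,
  1, -1 for \<open>a\<close>, \<open>b\<close>, \<open>b1\<close>, \<open>a1\<close>,
  \<open>b2\<close>, \<open>c\<close>.\<close>

lemma deriv_coefficients:
  assumes x: "x \<in> R"
  shows "(a_fun E has_field_derivative e3 x * g3 x) (at x)" (is ?a)
    and "(b_fun E has_field_derivative rho x * b_fun E x) (at x)" (is ?b)
    and "(b1_fun E has_field_derivative 2 * w3 x * g3 x - rho x * b1_fun E x) (at x)" (is ?b1)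
    and "(a1_fun E has_field_derivative 3 * (g3 x)^2 - 2 * rho x * a1_fun E x) (at x)" (is ?a1)
    and "(b2_fun E has_field_derivative (w3 x)^2) (at x)" (is ?b2)
    and "(c_fun E has_field_derivative 2 * rho x * c_fun E x - (e3 x)^2) (at x)" (is ?c)
proof -
  define m n where "m = 1 / x" and "n = 1 / (1 - x)"
  have "x \<noteq> 0" "x \<noteq> 1" using x R01 by auto
  then have mn: "m * x = 1" "n * (1 - x) = 1" "m * n = m + n" "1 / (x * (1 - x)) = m + n"
    by (auto simp: m_def n_def field_simps)
  have "\<i> * w1 x * w2 x / (x * (1 - x)) = \<i> * w1 x * w2 x * (m + n)"
    unfolding mn(4)[symmetric] by simp
  with dw(3)[OF x] have dw3: "(w3 has_field_derivative \<i> * w1 x * w2 x * (m + n)) (at x)" by simp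
  have dw': "(w1 has_field_derivative - \<i> * w2 x * w3 x * m) (at x)"
    "(w2 has_field_derivative - \<i> * w1 x * w3 x * n) (at x)"
    "(w3 has_field_derivative \<i> * w1 x * w2 x * (m + n)) (at x)"
    using dw(1,2)[OF x] dw3 by (simp_all add: m_def n_def)
  have de: "(e2 has_field_derivative - \<i> * w1 x * e3 x * n + rho x * e2 x) (at x)"
    "(e3 has_field_derivative \<i> * w2 x * e1 x * m + \<i> * w1 x * e2 x * n + rho x * e3 x) (at x)"
    "(g3 has_field_derivative \<i> * w2 x * g1 x * m + \<i> * w1 x * n - rho x * g3 x) (at x)"
    using deriv_frame[OF x] by (simp_all add: m_def n_def)
  have dg2: "((\<lambda>x. E x $ 2 $ 3) has_field_derivative 0) (at x)"
    by (rule has_field_derivative_transform_within_open[OF DERIV_const[of 1] open_R x]) (simp add: g)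
  have r: "rho x = - \<i> * w1 x * g3 x * n" by (simp add: rho_def n_def)
  have j: "\<i> * \<i> = -1" by simp
  note id = identities[OF x x x x x x x]
  have dprod: "((\<lambda>x. p x * q x + x * r x * s x) has_field_derivative
       p' * q x + p x * q' + r x * s x + x * (r' * s x + r x * s')) (at x)"
    if "(p has_field_derivative p') (at x)" "(q has_field_derivative q') (at x)"
      "(r has_field_derivative r') (at x)" "(s has_field_derivative s') (at x)" for p q r s p' q' r' s'
    by (rule derivative_eq_intros that refl | simp add: algebra_simps)+
  show ?a unfolding a_fun_def[abs_def]
    by (rule DERIV_cong[OF dprod[OF de(1) dg2 de(2) de(3)]]) (use id j mn g(2)[OF x] in \<open>unfold r, algebra\<close>)
  show ?b unfolding b_fun_def[abs_def]
    by (rule DERIV_cong[OF dprod[OF dw'(2) de(1) dw'(3) de(2)]]) (use id j mn in \<open>unfold r, algebra\<close>)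
  show ?b1 unfolding b1_fun_def[abs_def]
    by (rule DERIV_cong[OF dprod[OF dg2 dw'(2) de(3) dw'(3)]]) (use id j mn g(2)[OF x] in \<open>unfold r, algebra\<close>)
  have sq: "(\<lambda>x. (p x)^2 + x * (q x)^2) = (\<lambda>x. p x * p x + x * q x * q x)" for p q :: "complex \<Rightarrow> complex"
    by (simp add: power2_eq_square algebra_simps)
  show ?a1 unfolding a1_fun_def[abs_def] sq
    by (rule DERIV_cong[OF dprod[OF dg2 dg2 de(3) de(3)]]) (use id j mn g(2)[OF x] in \<open>unfold r, algebra\<close>)
  show ?b2 unfolding b2_fun_def[abs_def] sq
    by (rule DERIV_cong[OF dprod[OF dw'(2) dw'(2) dw'(3) dw'(3)]]) (use mn(1,2) in algebra)
  show ?c unfolding c_fun_def[abs_def] sq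
    by (rule DERIV_cong[OF dprod[OF de(1) de(1) de(2) de(2)]]) (use id j mn g(2)[OF x] in \<open>unfold r, algebra\<close>)
qed

text \<open>Rescaling the first column multiplies \<open>c\<close> and \<open>b^2\<close> by the
  same factor, so the \<open>rho\<close> terms cancel.\<close>

lemma deriv_c_over_b_squared:
  assumes x: "x \<in> R"
  shows "((\<lambda>x. - 9 * (c_fun E x / (b_fun E x)^2)) has_field_derivative 9 * (e3 x)^2 / (b_fun E x)^2) (at x)"
proof -
  note coef = deriv_coefficients[OF x]
  have "((\<lambda>x. (b_fun E x)^2) has_field_derivative 2 * rho x * (b_fun E x)^2) (at x)"
    by (rule derivative_eq_intros coef refl | simp add: power2_eq_square)+
  from DERIV_cmult[OF DERIV_divide[OF coef(6) this], of "-9"] show ?thesis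
    by (rule DERIV_cong) (use nz(4)[OF x] in \<open>simp_all add: field_simps\<close>)
qed

end

section \<open>Gradients and the WDVV equations\<close>

text \<open>Total differentiability over the reals, with a derivative that is complex-linear by its
  shape. This one notion yields both holomorphy in three variables and the values of the partial
  derivatives.\<close>

definition has_gradient :: "(complex^3 \<Rightarrow> complex) \<Rightarrow> (3 \<Rightarrow> complex) \<Rightarrow> complex^3 \<Rightarrow> bool" where
  "has_gradient F D p \<longleftrightarrow> (F has_derivative (\<lambda>v. \<Sum>i\<in>UNIV. D i * v $ i)) (at p)"

lemma has_gradient_cong: "has_gradient F D p \<Longrightarrow> (\<And>i. D i = D' i) \<Longrightarrow> has_gradient F D' p"
  by (simp add: has_gradient_def)

lemma has_gradient_transform_open:
  assumes "has_gradient F D p" "open W" "p \<in> W" "\<And>q. q \<in> W \<Longrightarrow> F q = G q"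
  shows "has_gradient G D p"
  using assms unfolding has_gradient_def by (rule has_derivative_transform_within_open)

lemma has_gradient_const: "has_gradient (\<lambda>p. k) (\<lambda>i. 0) p"
  by (simp add: has_gradient_def)

lemma has_gradient_component: "has_gradient (\<lambda>p. p $ j) (\<lambda>i. if i = j then 1 else 0) p"
proof -
  have "(\<lambda>v::complex^3. \<Sum>i\<in>UNIV. (if i = j then 1 else 0) * v $ i) = (\<lambda>v. v $ j)"
    by (simp add: if_distrib[of "\<lambda>z. z * _"] sum.delta' cong: if_cong)
  then show ?thesis
    unfolding has_gradient_def by (simp add: bounded_linear_imp_has_derivative bounded_linear_vec_nth)
qed

lemma has_gradient_add:
  "has_gradient F D p \<Longrightarrow> has_gradient G D' p \<Longrightarrow> has_gradient (\<lambda>q. F q + G q) (\<lambda>i. D i + D' i) p"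
  unfolding has_gradient_def by (drule (1) has_derivative_add) (simp add: sum.distrib distrib_right)

lemma has_gradient_diff:
  "has_gradient F D p \<Longrightarrow> has_gradient G D' p \<Longrightarrow> has_gradient (\<lambda>q. F q - G q) (\<lambda>i. D i - D' i) p"
  unfolding has_gradient_def by (drule (1) has_derivative_diff) (simp add: sum_subtractf left_diff_distrib)

lemma has_gradient_mult:
  "has_gradient F D p \<Longrightarrow> has_gradient G D' p \<Longrightarrow>
    has_gradient (\<lambda>q. F q * G q) (\<lambda>i. F p * D' i + D i * G p) p"
  unfolding has_gradient_def
  by (drule (1) has_derivative_mult) (simp add: sum.distrib sum_distrib_left sum_distrib_right algebra_simps)

lemma has_gradient_cmult: "has_gradient F D p \<Longrightarrow> has_gradient (\<lambda>q. k * F q) (\<lambda>i. k * D i) p"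
  by (rule has_gradient_cong[OF has_gradient_mult[OF has_gradient_const]]) auto

lemma has_gradient_chain:
  assumes "(h has_field_derivative h') (at (F p))" "has_gradient F D p"
  shows "has_gradient (\<lambda>q. h (F q)) (\<lambda>i. h' * D i) p"
  using has_derivative_compose[OF assms(2)[unfolded has_gradient_def] assms(1)[unfolded has_field_derivative_def]]
  unfolding has_gradient_def by (simp add: sum_distrib_left mult.assoc)

lemma has_gradient_compose:
  assumes "\<And>i. has_gradient (\<lambda>t. s t $ i) (K i) p" "has_gradient F D (s p)"
  shows "has_gradient (\<lambda>t. F (s t)) (\<lambda>j. \<Sum>i\<in>UNIV. D i * K i j) p"
proof -
  have "(s has_derivative (\<lambda>v. \<chi> i. \<Sum>j\<in>UNIV. K i j * v $ j)) (at p)"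
    using assms(1) unfolding has_gradient_def
    by (subst has_derivative_componentwise_within)
       (auto simp: Basis_vec_def inner_axis has_derivative_componentwise_within[symmetric]
         intro!: has_derivative_inner_left)
  from has_derivative_compose[OF this assms(2)[unfolded has_gradient_def]]
  show ?thesis unfolding has_gradient_def
    by (simp add: sum_distrib_left sum_distrib_right mult.assoc) (subst sum.swap, simp)
qed

lemma has_gradient_pd:
  assumes "has_gradient F D p" shows "pd \<alpha> F p = D \<alpha>"
proof -
  have "((\<lambda>z. p + axis \<alpha> z) has_derivative (\<lambda>z. axis \<alpha> z)) (at 0)"
  proof -
    have "linear (axis \<alpha> :: complex \<Rightarrow> complex^3)"
      by (auto simp: linear_iff axis_def vec_eq_iff)
    then show ?thesis
      by (auto intro!: derivative_eq_intros bounded_linear_imp_has_derivative simp: linear_conv_bounded_linear)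
  qed
  moreover have "(F has_derivative (\<lambda>v. \<Sum>i\<in>UNIV. D i * v $ i)) (at (p + axis \<alpha> 0))"
    using assms by (simp add: has_gradient_def axis_eq_0_iff[THEN iffD2])
  ultimately have "((\<lambda>z. F (p + axis \<alpha> z)) has_derivative (\<lambda>z. \<Sum>i\<in>UNIV. D i * axis \<alpha> z $ i)) (at 0)"
    by (rule has_derivative_compose)
  moreover have "(\<lambda>z. \<Sum>i\<in>UNIV. D i * axis \<alpha> z $ i) = (*) (D \<alpha>)"
    by (auto simp: axis_def if_distrib[of "\<lambda>z. _ * z"] sum.delta' cong: if_cong)
  ultimately show ?thesis
    unfolding pd_def by (intro DERIV_imp_deriv) (simp add: has_field_derivative_def)
qed

lemma has_gradient_imp_holomorphic_C3:
  "(\<And>p. p \<in> W \<Longrightarrow> has_gradient F (D p) p) \<Longrightarrow> holomorphic_C3 F W"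
  unfolding holomorphic_C3_def has_gradient_def
  by (fastforce simp: sum_distrib_left mult.left_commute)

section \<open>The flat metric, and potentials built from structure functions\<close>

lemma eta_3:
  "eta $ 1 $ 1 = 0" "eta $ 1 $ 2 = 0" "eta $ 1 $ 3 = 1" "eta $ 2 $ 1 = 0" "eta $ 2 $ 2 = 1"
  "eta $ 2 $ 3 = 0" "eta $ 3 $ 1 = 1" "eta $ 3 $ 2 = 0" "eta $ 3 $ 3 = 0"
  by (simp_all add: eta_def)

lemma eta_column:
  "eta $ i $ 1 = (if i = 3 then 1 else 0)" "eta $ i $ 2 = (if i = 2 then 1 else 0)" "eta $ i $ 3 = (if i = 1 then 1 else 0)"
  using exhaust_3[of i] by (auto simp: eta_3)

lemma matrix_inv_eta: "matrix_inv eta = eta"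
proof -
  have sq: "eta ** eta = mat 1"
    by (simp add: vec_eq_iff matrix_matrix_mult_def forall_3 sum_3 eta_3 mat_def)
  then have "eta ** matrix_inv eta = mat 1"
    unfolding matrix_inv_def by (rule someI2[of _ eta, OF conjI]) (auto simp: sq)
  then have "(eta ** eta) ** matrix_inv eta = eta"
    by (simp add: matrix_mul_assoc[symmetric])
  then show ?thesis by (simp add: sq)
qed

text \<open>Here \<open>c \<alpha> \<beta> \<gamma>\<close> plays the role of the third derivatives of \<open>F\<close>, and \<open>P22\<close>, \<open>P23\<close>, \<open>P33\<close> that of second
  derivatives. Applying the Euler field to \<open>F\<close> twice expresses \<open>F\<close> through its second derivatives,
  which gives the formula in the last assumption.\<close>

lemma WDVV_solution_from_structure_functions:
  fixes c :: "3 \<Rightarrow> 3 \<Rightarrow> 3 \<Rightarrow> complex^3 \<Rightarrow> complex"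
  assumes W: "open W"
    and sym: "\<And>\<alpha> \<beta> \<gamma> t. c \<alpha> \<beta> \<gamma> t = c \<beta> \<alpha> \<gamma> t" "\<And>\<alpha> \<beta> \<gamma> t. c \<alpha> \<beta> \<gamma> t = c \<alpha> \<gamma> \<beta> t"
    and unit: "\<And>\<alpha> \<beta> t. t \<in> W \<Longrightarrow> c 1 \<alpha> \<beta> t = eta $ \<alpha> $ \<beta>"
    and assoc: "\<And>\<alpha> \<beta> \<gamma> \<delta> t. t \<in> W \<Longrightarrow>
      (\<Sum>\<kappa>\<in>UNIV. \<Sum>\<nu>\<in>UNIV. c \<alpha> \<beta> \<kappa> t * eta $ \<kappa> $ \<nu> * c \<nu> \<gamma> \<delta> t)
      = (\<Sum>\<kappa>\<in>UNIV. \<Sum>\<nu>\<in>UNIV. c \<delta> \<beta> \<kappa> t * eta $ \<kappa> $ \<nu> * c \<nu> \<gamma> \<alpha> t)"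
    and grad: "\<And>t. t \<in> W \<Longrightarrow> has_gradient P22 (\<lambda>\<alpha>. c \<alpha> 2 2 t) t"
      "\<And>t. t \<in> W \<Longrightarrow> has_gradient P23 (\<lambda>\<alpha>. c \<alpha> 2 3 t) t"
      "\<And>t. t \<in> W \<Longrightarrow> has_gradient P33 (\<lambda>\<alpha>. c \<alpha> 3 3 t) t"
    and euler: "\<And>t. t \<in> W \<Longrightarrow> t $ 1 + 3 * c 2 2 2 t - t $ 3 * c 3 2 2 t = P22 t"
      "\<And>t. t \<in> W \<Longrightarrow> 3 * c 2 2 3 t - t $ 3 * c 3 2 3 t = 2 * P23 t"
      "\<And>t. t \<in> W \<Longrightarrow> 3 * c 2 3 3 t - t $ 3 * c 3 3 3 t = 3 * P33 t"
    and F: "\<And>t. t \<in> W \<Longrightarrow> F t = 1/2 * t $ 1 * (t $ 2)^2 + 1/2 * (t $ 1)^2 * t $ 3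
        + 9 * (P22 t - t $ 1) - 9/2 * (t $ 3 * P23 t) + 1/2 * ((t $ 3)^2 * P33 t)"
  shows "WDVV_solution 2 (vector [0, 1, 2]) (\<lambda>t. vector [t $ 1, 3, - t $ 3]) F W"
proof -
  \<comment> \<open>\<open>P\<close> is the intended Hessian of F. Its first row and column are the
    flat coordinates with lowered index, as the unit equation requires; index arithmetic is modulo
    3, where \<open>4 - \<beta>\<close> exchanges 1 and 3 and fixes 2.\<close>
  define P where "P \<alpha> \<beta> = (if \<alpha> = (1::3) then (\<lambda>t. t $ (4 - \<beta>)) else if \<beta> = (1::3) then (\<lambda>t. t $ (4 - \<alpha>))
     else if \<alpha> = 2 \<and> \<beta> = 2 then P22 else if \<alpha> = 3 \<and> \<beta> = 3 then P33 else P23)" for \<alpha> \<beta>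
  \<comment> \<open>\<open>G\<close> is the intended gradient. For the index 2 homogeneity reads
    \<open>Eu (\<partial>2 F) = \<partial>2 F + 3 t1\<close>, for the index 3 it reads
    \<open>Eu (\<partial>3 F) = 2 * \<partial>3 F\<close>; expanding the left sides in second
    derivatives and solving gives the formulae, including the summand \<open>- 3 t1\<close> and the
    factor 1/2.\<close>
  define G where "G \<alpha> t = (if \<alpha> = (1::3) then 1/2 * (t $ 2 * t $ 2) + t $ 1 * t $ 3
     else if \<alpha> = 2 then t $ 1 * t $ 2 + 3 * (P22 t - t $ 1) - t $ 3 * P23 t
     else 1/2 * (t $ 1 * t $ 1) + 1/2 * (3 * P23 t - t $ 3 * P33 t))" for \<alpha> and t :: "complex^3"
  have P: "P 1 1 = (\<lambda>t. t $ 3)" "P 1 2 = (\<lambda>t. t $ 2)" "P 1 3 = (\<lambda>t. t $ 1)"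
    "P 2 1 = (\<lambda>t. t $ 2)" "P 2 2 = P22" "P 2 3 = P23" "P 3 1 = (\<lambda>t. t $ 1)" "P 3 2 = P23" "P 3 3 = P33"
    by (simp_all add: P_def)
  have c1: "c \<alpha> 1 \<beta> t = eta $ \<alpha> $ \<beta>" "c \<alpha> \<beta> 1 t = eta $ \<alpha> $ \<beta>" if "t \<in> W" for \<alpha> \<beta> t
    using unit[OF that] sym by metis+
  note ops = has_gradient_add has_gradient_diff has_gradient_cmult has_gradient_mult has_gradient_component
  have dP: "has_gradient (P \<beta> \<gamma>) (\<lambda>\<alpha>. c \<alpha> \<beta> \<gamma> t) t" if "t \<in> W" for \<beta> \<gamma> t
  proof -
    have swap: "c \<alpha> 3 2 t = c \<alpha> 2 3 t" for \<alpha> using sym by metis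
    have "\<forall>\<beta> \<gamma>. has_gradient (P \<beta> \<gamma>) (\<lambda>\<alpha>. c \<alpha> \<beta> \<gamma> t) t"
      unfolding forall_3 P
      by (intro conjI has_gradient_cong[OF has_gradient_component] has_gradient_cong[OF grad(1)]
           has_gradient_cong[OF grad(2)] has_gradient_cong[OF grad(3)] that)
         (auto simp: c1[OF that] eta_column swap)
    then show ?thesis by blast
  qed
  have dG: "has_gradient (G \<gamma>) (\<lambda>\<beta>. P \<beta> \<gamma> t) t" if "t \<in> W" for \<gamma> t
  proof -
    note e = euler[OF that] and g = grad[OF that]
    have cs: "c 3 2 2 t = c 2 2 3 t" "c 3 2 3 t = c 2 3 3 t" using sym by metis+
    have "\<forall>\<gamma>. has_gradient (G \<gamma>) (\<lambda>\<beta>. P \<beta> \<gamma> t) t"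
      unfolding forall_3
    proof (intro conjI)
      have "G 1 = (\<lambda>t. 1/2 * (t $ 2 * t $ 2) + t $ 1 * t $ 3)" by (simp add: G_def fun_eq_iff)
      moreover have "has_gradient (\<lambda>t. 1/2 * (t $ 2 * t $ 2) + t $ 1 * t $ 3) (\<lambda>\<beta>. P \<beta> 1 t) t"
      proof (rule has_gradient_cong, (rule ops)+, goal_cases)
        case (1 i)
        then show ?case using exhaust_3[of i] by (auto simp: P)
      qed
      ultimately show "has_gradient (G 1) (\<lambda>\<beta>. P \<beta> 1 t) t" by simp
      have "G 2 = (\<lambda>t. t $ 1 * t $ 2 + 3 * (P22 t - t $ 1) - t $ 3 * P23 t)" by (simp add: G_def fun_eq_iff)
      moreover have "has_gradient (\<lambda>t. t $ 1 * t $ 2 + 3 * (P22 t - t $ 1) - t $ 3 * P23 t) (\<lambda>\<beta>. P \<beta> 2 t) t"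
      proof (rule has_gradient_cong, (rule ops g)+, goal_cases)
        case (1 i)
        then show ?case using exhaust_3[of i] e cs by (auto simp: P c1[OF that] unit[OF that] eta_3)
      qed
      ultimately show "has_gradient (G 2) (\<lambda>\<beta>. P \<beta> 2 t) t" by simp
      have "G 3 = (\<lambda>t. 1/2 * (t $ 1 * t $ 1) + 1/2 * (3 * P23 t - t $ 3 * P33 t))" by (simp add: G_def fun_eq_iff)
      moreover have "has_gradient (\<lambda>t. 1/2 * (t $ 1 * t $ 1) + 1/2 * (3 * P23 t - t $ 3 * P33 t)) (\<lambda>\<beta>. P \<beta> 3 t) t"
      proof (rule has_gradient_cong, (rule ops g)+, goal_cases)
        case (1 i)
        then show ?case using exhaust_3[of i] e cs by (auto simp: P c1[OF that] unit[OF that] eta_3 field_simps)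
      qed
      ultimately show "has_gradient (G 3) (\<lambda>\<beta>. P \<beta> 3 t) t" by simp
    qed
    then show ?thesis by blast
  qed
  have dF: "has_gradient F (\<lambda>\<gamma>. G \<gamma> t) t" if "t \<in> W" for t
  proof (rule has_gradient_transform_open[OF _ W that])
    note e = euler[OF that] and g = grad[OF that]
    have cs: "c 3 2 2 t = c 2 2 3 t" "c 3 2 3 t = c 2 3 3 t" using sym by metis+
    show "has_gradient (\<lambda>t. 1/2 * (t $ 1 * (t $ 2 * t $ 2)) + 1/2 * ((t $ 1 * t $ 1) * t $ 3)
        + 9 * (P22 t - t $ 1) - 9/2 * (t $ 3 * P23 t) + 1/2 * ((t $ 3 * t $ 3) * P33 t)) (\<lambda>\<gamma>. G \<gamma> t) t"
    proof (rule has_gradient_cong, (rule ops g)+, goal_cases)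
      case (1 i)
      have Ps: "P22 t = t $ 1 + 3 * c 2 2 2 t - t $ 3 * c 2 2 3 t"
        "P23 t = (3 * c 2 2 3 t - t $ 3 * c 2 3 3 t) / 2"
        "P33 t = (3 * c 2 3 3 t - t $ 3 * c 3 3 3 t) / 3" using e cs by simp_all
      show ?case using exhaust_3[of i]
        by (elim disjE) (simp_all add: G_def P c1[OF that] unit[OF that] eta_3 cs Ps, simp_all add: field_simps)
    qed
  qed (simp add: F power2_eq_square)
  have pd1: "pd \<gamma> F t = G \<gamma> t" if "t \<in> W" for \<gamma> t
    by (rule has_gradient_pd[OF dF[OF that]])
  have pd2: "pd \<beta> (pd \<gamma> F) t = P \<beta> \<gamma> t" if "t \<in> W" for \<beta> \<gamma> t
    by (rule has_gradient_pd, rule has_gradient_transform_open[OF dG[OF that] W that]) (simp add: pd1)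
  have pd3: "pd \<alpha> (pd \<beta> (pd \<gamma> F)) t = c \<alpha> \<beta> \<gamma> t" if "t \<in> W" for \<alpha> \<beta> \<gamma> t
    by (rule has_gradient_pd, rule has_gradient_transform_open[OF dP[OF that] W that]) (simp add: pd2)
  show ?thesis
    unfolding WDVV_solution_def matrix_inv_eta
  proof (intro conjI ballI allI)
    show "holomorphic_C3 F W" by (rule has_gradient_imp_holomorphic_C3[OF dF])
    show "euler_vector_field 2 (vector [0, 1, 2]) (\<lambda>t. vector [t $ 1, 3, - t $ 3])"
      unfolding euler_vector_field_def
    proof (intro conjI)
      show "\<exists>r :: complex^3. (\<forall>\<alpha>. vector [0, 1, 2] $ \<alpha> \<noteq> (1::complex) \<longrightarrow> r $ \<alpha> = 0) \<and>
        (\<forall>t. vector [t $ 1, 3, - t $ 3] = (\<chi> \<alpha>. (1 - vector [0, 1, 2] $ \<alpha>) * t $ \<alpha> + r $ \<alpha>))"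
        by (rule exI[of _ "vector [0, 3, 0]"]) (simp add: vec_eq_iff forall_3 vector_3)
    qed (simp_all add: forall_3 vector_3)
    show "\<exists>(Q :: complex^3^3) (B :: complex^3) C. \<forall>t\<in>W.
        (\<Sum>\<alpha>\<in>UNIV. vector [t $ 1, 3, - t $ 3] $ \<alpha> * pd \<alpha> F t) =
          (3 - 2) * F t + (\<Sum>\<alpha>\<in>UNIV. \<Sum>\<beta>\<in>UNIV. Q $ \<alpha> $ \<beta> * t $ \<alpha> * t $ \<beta>)
            + (\<Sum>\<alpha>\<in>UNIV. B $ \<alpha> * t $ \<alpha>) + C"
      \<comment> \<open>The quadratic defect is \<open>3 t1 t2\<close>: it comes from the constant
        component 3 of the Euler field acting on the cubic term
        \<open>1/2 t1 (t2)^2\<close>.\<close>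
      by (rule exI[of _ "vector [vector [0, 3, 0], vector [0, 0, 0], vector [0, 0, 0]]"], rule exI[of _ 0], rule exI[of _ 0])
        (simp add: sum_3 vector_3 pd1 G_def F field_simps power2_eq_square)
  qed (simp_all add: pd3 assoc unit)
qed

section \<open>Local inversion of holomorphic maps in three variables\<close>

lemma bounded_linear_complex_matrix_vector: "bounded_linear ((*v) (A :: complex^3^3))"
  by (auto simp: linear_conv_bounded_linear[symmetric] linear_iff matrix_vector_mult_def vec_eq_iff
      distrib_left sum.distrib scaleR_sum_right)

text \<open>The real inverse function theorem suffices: the derivative of the inverse is the inverse
  of the real-linear map given by \<open>J\<close>, which is multiplication by the complex matrix
  \<open>K\<close> and therefore complex-linear.\<close>

lemma holomorphic_inverse_function:
  fixes g :: "complex^3 \<Rightarrow> complex^3" and J K :: "complex^3 \<Rightarrow> complex^3^3"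
  assumes S: "open S" "u0 \<in> S"
    and grad: "\<And>u \<gamma>. u \<in> S \<Longrightarrow> has_gradient (\<lambda>u. g u $ \<gamma>) (\<lambda>i. J u $ \<gamma> $ i) u"
    and cont: "\<And>\<gamma> i. continuous_on S (\<lambda>u. J u $ \<gamma> $ i)"
    and inv: "\<And>u. u \<in> S \<Longrightarrow> J u ** K u = mat 1"
  obtains N W s where "open N" "u0 \<in> N" "N \<subseteq> S" "open W" "homeomorphism N W g s"
    "\<And>t i. t \<in> W \<Longrightarrow> has_gradient (\<lambda>t. s t $ i) (\<lambda>\<gamma>. K (s t) $ i $ \<gamma>) t"
proof -
  define f' where "f' u = Blinfun ((*v) (J u))" for u
  have f': "blinfun_apply (f' u) = (*v) (J u)" for u
    by (simp add: f'_def bounded_linear_Blinfun_apply bounded_linear_complex_matrix_vector)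
  have inv': "K u ** J u = mat 1" if "u \<in> S" for u
    using inv[OF that] matrix_left_right_inverse by blast
  have der: "(g has_derivative blinfun_apply (f' u)) (at u)" if "u \<in> S" for u
    unfolding f' matrix_vector_mult_def using grad[OF that] unfolding has_gradient_def
    by (subst has_derivative_componentwise_within)
       (auto simp: Basis_vec_def inner_axis intro!: has_derivative_inner_left)
  have contf: "continuous_on S f'"
    by (rule continuous_on_blinfun_componentwise)
       (auto simp: f' matrix_vector_mult_def intro!: continuous_on_vec_lambda continuous_intros cont)
  have id: "Blinfun ((*v) (K u0)) o\<^sub>L f' u0 = id_blinfun"
    by (rule blinfun_eqI)
       (simp add: f' bounded_linear_Blinfun_apply bounded_linear_complex_matrix_vector
         matrix_vector_mul_assoc inv'[OF S(2)])
  obtain N W s s' where N: "open N" "N \<subseteq> S" "u0 \<in> N" "open W" "homeomorphism N W g s"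
    and s: "\<And>t. t \<in> W \<Longrightarrow> (s has_derivative s' t) (at t)"
      "\<And>t. t \<in> W \<Longrightarrow> s' t = Hilbert_Choice.inv (blinfun_apply (f' (s t)))"
    using inverse_function_theorem[OF S(1) der contf S(2) id] by metis
  have "has_gradient (\<lambda>t. s t $ i) (\<lambda>\<gamma>. K (s t) $ i $ \<gamma>) t" if t: "t \<in> W" for t i
  proof -
    have st: "s t \<in> S" using N(2,5) t by (auto simp: homeomorphism_def)
    have "s' t = (*v) (K (s t))"
      unfolding s(2)[OF t] f'
      by (rule inv_unique_comp) (auto simp: fun_eq_iff matrix_vector_mul_assoc inv inv' st)
    with s(1)[OF t] have "(s has_derivative (*v) (K (s t))) (at t)" by simp
    from bounded_linear.has_derivative[OF bounded_linear_vec_nth[of i] this]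
    show ?thesis by (simp add: has_gradient_def matrix_vector_mult_def)
  qed
  with N that show thesis by blast
qed

section \<open>Differentiation in the variables x and H\<close>

lemma
  assumes "H_of u \<noteq> 0"
  shows has_gradient_H_of: "has_gradient H_of (\<lambda>i. if i = 1 then - 1 else if i = 2 then 1 else 0) u"
    and has_gradient_x_of: "has_gradient x_of
      (\<lambda>i. if i = 1 then (x_of u - 1) / H_of u else if i = 2 then - x_of u / H_of u else 1 / H_of u) u"
proof -
  show dH: "has_gradient H_of (\<lambda>i. if i = 1 then - 1 else if i = 2 then 1 else 0) u" for u
    unfolding H_of_def[abs_def]
    by (rule has_gradient_cong[OF has_gradient_diff[OF has_gradient_component has_gradient_component]]) auto
  have "((\<lambda>h. 1 / h) has_field_derivative - 1 / (H_of u)^2) (at (H_of u))"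
    using DERIV_inverse[OF assms] by (simp add: inverse_eq_divide power2_eq_square divide_inverse[symmetric] flip: divide_inverse)
  from has_gradient_mult[OF has_gradient_diff[OF has_gradient_component[of 3] has_gradient_component[of 1]]
      has_gradient_chain[OF this dH]]
  have d: "has_gradient (\<lambda>u. (u $ 3 - u $ 1) * (1 / H_of u)) (\<lambda>i. (u $ 3 - u $ 1) * (- 1 / (H_of u)^2 * (if i = 1 then - 1 else if i = 2 then 1 else 0))
     + ((if i = 3 then 1 else 0) - (if i = 1 then 1 else 0)) * (1 / H_of u)) u" .
  have x: "u $ 3 - u $ 1 = x_of u * H_of u" using assms by (simp add: x_of_def H_of_def)
  have "has_gradient (\<lambda>u. (u $ 3 - u $ 1) * (1 / H_of u))
      (\<lambda>i. if i = 1 then (x_of u - 1) / H_of u else if i = 2 then - x_of u / H_of u else 1 / H_of u) u"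
  proof (rule has_gradient_cong[OF d])
    show "(u $ 3 - u $ 1) * (- 1 / (H_of u)^2 * (if i = 1 then - 1 else if i = 2 then 1 else 0))
        + ((if i = 3 then 1 else 0) - (if i = 1 then 1 else 0)) * (1 / H_of u)
      = (if i = 1 then (x_of u - 1) / H_of u else if i = 2 then - x_of u / H_of u else 1 / H_of u)" for i :: 3
      using exhaust_3[of i] assms unfolding x by (auto simp: field_simps power2_eq_square)
  qed
  then show "has_gradient x_of
      (\<lambda>i. if i = 1 then (x_of u - 1) / H_of u else if i = 2 then - x_of u / H_of u else 1 / H_of u) u"
    by (rule has_gradient_transform_open[OF _ open_UNIV]) (simp_all add: x_of_def H_of_def)
qed

text \<open>Apart from \<open>t2\<close>, all functions of the chart are homogeneous: up to a
  summand \<open>u $ 1\<close> they are a power of H times a function of x.\<close>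

lemma has_gradient_separated:
  assumes "H_of u \<noteq> 0" "(h has_field_derivative h') (at (H_of u))" "(q has_field_derivative q') (at (x_of u))"
  shows "has_gradient (\<lambda>u. h (H_of u) * q (x_of u)) (\<lambda>i. if i = 1 then h (H_of u) * q' * ((x_of u - 1) / H_of u) - h' * q (x_of u)
     else if i = 2 then h' * q (x_of u) - h (H_of u) * q' * (x_of u / H_of u) else h (H_of u) * q' / H_of u) u"
  by (rule has_gradient_cong[OF has_gradient_mult[OF has_gradient_chain[OF assms(2) has_gradient_H_of[OF assms(1)]]
       has_gradient_chain[OF assms(3) has_gradient_x_of[OF assms(1)]]]]) auto

lemma log_branch_has_field_derivative:
  assumes "log_branch L \<Lambda>" "open \<Lambda>" "h \<in> \<Lambda>"
  shows "(L has_field_derivative 1 / h) (at h)" and "h \<noteq> 0"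
proof -
  have hol: "L holomorphic_on \<Lambda>" and ex: "\<And>h. h \<in> \<Lambda> \<Longrightarrow> exp (L h) = h"
    using assms(1) by (auto simp: log_branch_def)
  show h0: "h \<noteq> 0" using ex[OF assms(3)] exp_not_eq_zero by metis
  have d: "(L has_field_derivative deriv L h) (at h)" by (rule holomorphic_derivI[OF hol assms(2,3)])
  have "((\<lambda>h. exp (L h)) has_field_derivative exp (L h) * deriv L h) (at h)"
    by (rule derivative_eq_intros d refl | simp)+
  then have "((\<lambda>h. h) has_field_derivative exp (L h) * deriv L h) (at h)"
    by (rule has_field_derivative_transform_within_open[OF _ assms(2,3)]) (simp add: ex)
  then have "h * deriv L h = 1" using DERIV_unique[OF _ DERIV_ident] ex[OF assms(3)] by metis
  then have "deriv L h = 1 / h" using h0 by (simp add: nonzero_eq_divide_eq mult.commute)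
  with d show "(L has_field_derivative 1 / h) (at h)" by simp
qed

text \<open>Orthonormality of the columns makes \<open>eta ** transpose \<Psi>\<close> a left
  inverse of the square matrix \<open>\<Psi>\<close>, hence also a right inverse.\<close>

lemma orthonormal_frame_rows:
  fixes \<psi> :: "3 \<Rightarrow> 3 \<Rightarrow> complex"
  assumes "\<And>\<alpha> \<beta>. (\<Sum>i\<in>UNIV. \<psi> i \<alpha> * \<psi> i \<beta>) = eta $ \<alpha> $ \<beta>"
  shows "\<psi> i 1 * \<psi> j 3 + \<psi> i 2 * \<psi> j 2 + \<psi> i 3 * \<psi> j 1 = (if i = j then 1 else 0)"
proof -
  define \<Psi> :: "complex^3^3" where "\<Psi> = (\<chi> i \<alpha>. \<psi> i \<alpha>)"
  have "transpose \<Psi> ** \<Psi> = eta"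
    by (simp add: \<Psi>_def vec_eq_iff matrix_matrix_mult_def transpose_def assms)
  moreover have "eta ** eta = mat 1"
    by (simp add: vec_eq_iff matrix_matrix_mult_def forall_3 sum_3 eta_3 mat_def)
  ultimately have "(eta ** transpose \<Psi>) ** \<Psi> = mat 1" by (simp add: matrix_mul_assoc[symmetric])
  then have "\<Psi> ** (eta ** transpose \<Psi>) = mat 1" by (simp add: matrix_left_right_inverse)
  then have "(\<Psi> ** (eta ** transpose \<Psi>)) $ i $ j = (if i = j then 1 else 0)" by (simp add: mat_def)
  then show ?thesis
    by (simp add: \<Psi>_def matrix_matrix_mult_def transpose_def sum_3 eta_3 algebra_simps)
qed

text \<open>Contracting with \<open>eta\<close> collapses the double sum over frame indices to its
  diagonal: in the frame the multiplication is componentwise. The resulting sum is symmetric in all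
  four free indices, and this symmetry is associativity.\<close>

lemma orthonormal_frame_associativity:
  fixes \<psi> :: "3 \<Rightarrow> 3 \<Rightarrow> complex"
  assumes "\<And>\<alpha> \<beta>. (\<Sum>i\<in>UNIV. \<psi> i \<alpha> * \<psi> i \<beta>) = eta $ \<alpha> $ \<beta>"
  defines "c \<equiv> \<lambda>\<alpha> \<beta> \<gamma>. \<Sum>i\<in>UNIV. \<psi> i \<alpha> * \<psi> i \<beta> * \<psi> i \<gamma> / \<psi> i 1"
  shows "(\<Sum>\<kappa>\<in>UNIV. \<Sum>\<nu>\<in>UNIV. c \<alpha> \<beta> \<kappa> * eta $ \<kappa> $ \<nu> * c \<nu> \<gamma> \<delta>)
    = (\<Sum>i\<in>UNIV. \<psi> i \<alpha> * \<psi> i \<beta> * \<psi> i \<gamma> * \<psi> i \<delta> / (\<psi> i 1)^2)"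
proof -
  have contract: "(\<Sum>\<kappa>\<in>UNIV. \<Sum>\<nu>\<in>UNIV. (\<Sum>i\<in>UNIV. A i * \<psi> i \<kappa>) * eta $ \<kappa> $ \<nu> * (\<Sum>j\<in>UNIV. B j * \<psi> j \<nu>))
    = (\<Sum>i\<in>UNIV. A i * B i)" for A B
  proof -
    have "(\<Sum>\<kappa>\<in>UNIV. \<Sum>\<nu>\<in>UNIV. (\<Sum>i\<in>UNIV. A i * \<psi> i \<kappa>) * eta $ \<kappa> $ \<nu> * (\<Sum>j\<in>UNIV. B j * \<psi> j \<nu>))
      = (\<Sum>i\<in>UNIV. \<Sum>j\<in>UNIV. A i * B j * (\<psi> i 1 * \<psi> j 3 + \<psi> i 2 * \<psi> j 2 + \<psi> i 3 * \<psi> j 1))"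
      by (simp add: sum_3 eta_3 algebra_simps)
    also have "\<dots> = (\<Sum>i\<in>UNIV. A i * B i)"
      unfolding orthonormal_frame_rows[OF assms(1)] by (simp add: sum.delta if_distrib[of "\<lambda>z. _ * z"] cong: if_cong)
    finally show ?thesis .
  qed
  have "c \<alpha> \<beta> \<kappa> = (\<Sum>i\<in>UNIV. (\<psi> i \<alpha> * \<psi> i \<beta> / \<psi> i 1) * \<psi> i \<kappa>)"
    "c \<nu> \<gamma> \<delta> = (\<Sum>i\<in>UNIV. (\<psi> i \<gamma> * \<psi> i \<delta> / \<psi> i 1) * \<psi> i \<nu>)" for \<kappa> \<nu>
    unfolding c_def by (rule sum.cong, simp, simp add: mult_ac)+
  then show ?thesis
    by (simp only: contract) (simp add: power2_eq_square mult_ac)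
qed

section \<open>The chart given by the parametric formulae\<close>

locale PVI_chart = PVI_frame +
  fixes L :: "complex \<Rightarrow> complex" and \<Lambda> :: "complex set"
  assumes open_\<Lambda>: "open \<Lambda>" and log: "log_branch L \<Lambda>"
begin

text \<open>Distinctness of the three coordinates is implicit: \<open>R\<close> avoids 0 and 1, and
  a domain of a logarithm avoids 0.\<close>

definition S :: "(complex^3) set" where "S = {u. x_of u \<in> R \<and> H_of u \<in> \<Lambda>}"

definition psi :: "complex^3 \<Rightarrow> 3 \<Rightarrow> 3 \<Rightarrow> complex" where
  "psi u i \<alpha> = (if \<alpha> = 1 then E (x_of u) $ i $ 1 / f_fun E (x_of u) (H_of u)
     else if \<alpha> = 2 then E (x_of u) $ i $ 2 else f_fun E (x_of u) (H_of u) * E (x_of u) $ i $ 3)"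

text \<open>Second derivatives of the potential, up to pullback: by homogeneity
  \<open>(1 - d + q\<^sub>\<alpha> + q\<^sub>\<beta>) P\<^sub>\<alpha>\<^sub>\<beta> = \<Sum>\<^sub>i u\<^sub>i \<psi>\<^sub>i\<^sub>\<alpha> \<psi>\<^sub>i\<^sub>\<beta>\<close>.\<close>

definition P22 where "P22 u = u $ 1 + H_of u * b2_fun E (x_of u)"
definition P23 where "P23 u = (H_of u)^2 * (b_fun E (x_of u) * b1_fun E (x_of u) / 6)"
definition P33 where "P33 u = (H_of u)^3 * (a1_fun E (x_of u) * (b_fun E (x_of u))^2 / 27)"

lemma S_D:
  assumes "u \<in> S"
  shows "x_of u \<in> R" "H_of u \<in> \<Lambda>" "H_of u \<noteq> 0" "f_fun E (x_of u) (H_of u) \<noteq> 0"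
  using assms nz(4) log_branch_has_field_derivative(2)[OF log open_\<Lambda>] by (auto simp: S_def f_fun_def)

lemma open_S: "open S"
proof -
  have c: "continuous_on UNIV H_of" unfolding H_of_def by (intro continuous_intros)
  then have o: "open (H_of -` \<Lambda>)" using open_\<Lambda> open_vimage by blast
  have "0 \<notin> \<Lambda>" using log_branch_has_field_derivative(2)[OF log open_\<Lambda>] by blast
  then have "continuous_on (H_of -` \<Lambda>) x_of"
    unfolding x_of_def by (intro continuous_intros) (auto simp: H_of_def)
  from continuous_open_preimage[OF this o open_R]
  have "open (H_of -` \<Lambda> \<inter> x_of -` R)" .
  moreover have "H_of -` \<Lambda> \<inter> x_of -` R = S" by (auto simp: S_def)
  ultimately show ?thesis by simp
qed

lemma psi_columns:
  assumes u: "u \<in> S"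
  shows "(\<Sum>i\<in>UNIV. psi u i \<alpha> * psi u i \<beta>) = eta $ \<alpha> $ \<beta>"
proof -
  note x = S_D(1)[OF u] and f = S_D(4)[OF u]
  note col = identities(4-8)[OF x x x x x x x] and g2 = g(2)[OF x]
  have "\<forall>\<alpha> \<beta>. (\<Sum>i\<in>UNIV. psi u i \<alpha> * psi u i \<beta>) = eta $ \<alpha> $ \<beta>"
    unfolding forall_3 sum_3 eta_3 psi_def
    using f col g2 norm[OF x]
    by (simp add: power2_eq_square mult_ac add_divide_distrib[symmetric] distrib_left[symmetric]) algebra
  then show ?thesis by blast
qed

lemma psi_nonzero: "u \<in> S \<Longrightarrow> psi u i 1 \<noteq> 0"
  using S_D[of u] nz exhaust_3[of i] by (auto simp: psi_def)

text \<open>Each component has its own source: the third is the x-derivative, where the product of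
  entries of the third row appears; the second adds homogeneity in H and then reduces to the
  definition of the coefficient; the first follows by orthogonality of the columns, which fixes the
  sum of the three.\<close>

lemma gradients:
  assumes u: "u \<in> S"
  shows "has_gradient (\<lambda>u. t_map E L T u $ \<gamma>) (\<lambda>i. psi u i 1 * psi u i (4 - \<gamma>)) u"
    and "has_gradient P22 (\<lambda>i. psi u i 2 * psi u i 2) u"
    and "has_gradient P23 (\<lambda>i. psi u i 2 * psi u i 3) u"
    and "has_gradient P33 (\<lambda>i. psi u i 3 * psi u i 3) u"
proof -
  define x H where "x = x_of u" and "H = H_of u"
  note x = S_D(1)[OF u, folded x_def] and H = S_D(2,3)[OF u, folded H_def]
  note H' = S_D(3)[OF u]
  note coef = deriv_coefficients[OF x]
  note col = identities(4-8)[OF x x x x x x x] and g2 = g(2)[OF x]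
  have b0: "b_fun E x \<noteq> 0" by (rule nz(4)[OF x])
  have f: "f_fun E x H = H / 3 * b_fun E x" by (simp add: f_fun_def)
  have psi: "psi u i 1 = E x $ i $ 1 / (H / 3 * b_fun E x)" "psi u i 2 = E x $ i $ 2"
     "psi u i 3 = H / 3 * b_fun E x * E x $ i $ 3" for i
    by (simp_all add: psi_def x_def[symmetric] H_def[symmetric] f)
  note sep = has_gradient_separated[OF H', folded x_def H_def]
  have t1: "has_gradient (\<lambda>u. u $ 1 + H_of u * a_fun E (x_of u)) (\<lambda>i. psi u i 1 * psi u i 3) u"
  proof (rule has_gradient_cong[OF has_gradient_add[OF has_gradient_component sep[OF DERIV_ident coef(1)]]])
    fix i :: 3
    show "(if i = 1 then 1 else 0) + (if i = 1 then H * (e3 x * g3 x) * ((x - 1) / H) - 1 * a_fun E x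
        else if i = 2 then 1 * a_fun E x - H * (e3 x * g3 x) * (x / H) else H * (e3 x * g3 x) / H) = psi u i 1 * psi u i 3"
      using exhaust_3[of i] H b0 col(3) g2
      by (elim disjE; simp add: psi a_fun_def; simp add: algebra_simps)
  qed
  have t2: "has_gradient (\<lambda>u. 3 * L (H_of u) + 3 * T (x_of u)) (\<lambda>i. psi u i 1 * psi u i 2) u"
  proof (rule has_gradient_cong[OF has_gradient_add[OF has_gradient_cmult[OF has_gradient_chain[OF _ has_gradient_H_of[OF H']]]
         has_gradient_cmult[OF has_gradient_chain[OF _ has_gradient_x_of[OF H']]]], folded x_def H_def])
    show "(L has_field_derivative 1 / H) (at H)" by (rule log_branch_has_field_derivative[OF log open_\<Lambda> H(1)])
    show "(T has_field_derivative e3 x * w3 x / b_fun E x) (at x)" by (rule dT[OF x])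
    fix i :: 3
    have 2: "e2 x * w2 x = b_fun E x - x * (e3 x * w3 x)" by (simp add: b_fun_def algebra_simps)
    have 1: "e1 x * w1 x = (x - 1) * (e3 x * w3 x) - b_fun E x"
      using col(2) unfolding b_fun_def by algebra
    have p: "E x $ i $ 1 * E x $ i $ 2 = (if i = 1 then (x - 1) * (e3 x * w3 x) - b_fun E x else if i = 2 then b_fun E x - x * (e3 x * w3 x) else e3 x * w3 x)"
      using exhaust_3[of i] 1 2 by (elim disjE) simp_all
    have r: "psi u i 1 * psi u i 2 = 3 * (E x $ i $ 1 * E x $ i $ 2) / (H * b_fun E x)" by (simp add: psi field_simps power2_eq_square)
    show "3 * (1 / H * (if i = 1 then - 1 else if i = 2 then 1 else 0)) + 3 * (e3 x * w3 x / b_fun E x *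
        (if i = 1 then (x - 1) / H else if i = 2 then - x / H else 1 / H)) = psi u i 1 * psi u i 2"
      unfolding r p using H(2) b0 by (auto simp: field_simps power2_eq_square power3_eq_cube)
  qed
  note dq = deriv_c_over_b_squared[OF x]
  have "has_gradient (\<lambda>u. 1 / H_of u * (- 9 * (c_fun E (x_of u) / (b_fun E (x_of u))^2))) (\<lambda>i. psi u i 1 * psi u i 1) u"
  proof (rule has_gradient_cong[OF sep[OF _ dq]])
    show "((\<lambda>h. 1 / h) has_field_derivative - 1 / H^2) (at H)"
      using H by (auto intro!: derivative_eq_intros simp: power2_eq_square)
    fix i :: 3
    have 2: "(e2 x)^2 = c_fun E x - x * (e3 x)^2" by (simp add: c_fun_def algebra_simps)
    have 1: "(e1 x)^2 = (x - 1) * (e3 x)^2 - c_fun E x"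
      using col(1) unfolding c_fun_def by algebra
    have p: "(E x $ i $ 1)^2 = (if i = 1 then (x - 1) * (e3 x)^2 - c_fun E x else if i = 2 then c_fun E x - x * (e3 x)^2 else (e3 x)^2)"
      using exhaust_3[of i] 1 2 by (elim disjE) simp_all
    have r: "psi u i 1 * psi u i 1 = 9 * (E x $ i $ 1)^2 / (H^2 * (b_fun E x)^2)" by (simp add: psi field_simps power2_eq_square)
    show "(if i = 1 then 1 / H * (9 * (e3 x)^2 / (b_fun E x)^2) * ((x - 1) / H) - - 1 / H^2 * (- 9 * (c_fun E x / (b_fun E x)^2))
        else if i = 2 then - 1 / H^2 * (- 9 * (c_fun E x / (b_fun E x)^2)) - 1 / H * (9 * (e3 x)^2 / (b_fun E x)^2) * (x / H)
        else 1 / H * (9 * (e3 x)^2 / (b_fun E x)^2) / H) = psi u i 1 * psi u i 1"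
      unfolding r p using H(2) b0 by (auto simp: field_simps power2_eq_square power3_eq_cube)
  qed
  then have t3: "has_gradient (\<lambda>u. t3_fun E (x_of u) (H_of u)) (\<lambda>i. psi u i 1 * psi u i 1) u"
    by (rule has_gradient_transform_open[OF _ open_S u])
      (use S_D nz(4) in \<open>auto simp: t3_fun_def f_fun_def power2_eq_square mult_ac\<close>)
  have "\<forall>\<gamma>. has_gradient (\<lambda>u. t_map E L T u $ \<gamma>) (\<lambda>i. psi u i 1 * psi u i (4 - \<gamma>)) u"
    unfolding forall_3 t_map_def vector_3 using t1 t2 t3 by (simp add: t2_fun_def mult.commute)
  then show "has_gradient (\<lambda>u. t_map E L T u $ \<gamma>) (\<lambda>i. psi u i 1 * psi u i (4 - \<gamma>)) u" by blast
  show "has_gradient P22 (\<lambda>i. psi u i 2 * psi u i 2) u"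
    unfolding P22_def[abs_def]
  proof (rule has_gradient_cong[OF has_gradient_add[OF has_gradient_component sep[OF DERIV_ident coef(5)]]])
    fix i :: 3
    show "(if i = 1 then 1 else 0) + (if i = 1 then H * (w3 x)^2 * ((x - 1) / H) - 1 * b2_fun E x
        else if i = 2 then 1 * b2_fun E x - H * (w3 x)^2 * (x / H) else H * (w3 x)^2 / H) = psi u i 2 * psi u i 2"
      using exhaust_3[of i] H norm[OF x]
      by (elim disjE; simp add: psi b2_fun_def; simp add: algebra_simps power2_eq_square)
  qed
  have dbb: "((\<lambda>x. b_fun E x * b1_fun E x / 6) has_field_derivative b_fun E x * w3 x * g3 x / 3) (at x)"
    by (rule DERIV_cong[OF DERIV_cdivide[OF DERIV_mult[OF coef(2,3)]]]) (simp add: field_simps)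
  have dh2: "((\<lambda>h. h^2) has_field_derivative 2 * H) (at H)"
    by (rule derivative_eq_intros refl | simp)+
  show "has_gradient P23 (\<lambda>i. psi u i 2 * psi u i 3) u"
    unfolding P23_def[abs_def]
  proof (rule has_gradient_cong[OF sep[OF dh2 dbb]])
    fix i :: 3
    have 2: "w2 x = b1_fun E x - x * (w3 x * g3 x)" by (simp add: b1_fun_def g2 algebra_simps)
    have 1: "w1 x * g1 x = (x - 1) * (w3 x * g3 x) - b1_fun E x"
      using col(4) g2 unfolding b1_fun_def by algebra
    have p: "E x $ i $ 2 * E x $ i $ 3 = (if i = 1 then (x - 1) * (w3 x * g3 x) - b1_fun E x else if i = 2 then b1_fun E x - x * (w3 x * g3 x) else w3 x * g3 x)"
      using exhaust_3[of i] 1 2 g2 by (elim disjE) simp_all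
    have r: "psi u i 2 * psi u i 3 = H * b_fun E x * (E x $ i $ 2 * E x $ i $ 3) / 3" by (simp add: psi field_simps power2_eq_square)
    show "(if i = 1 then H^2 * (b_fun E x * w3 x * g3 x / 3) * ((x - 1) / H) - 2 * H * (b_fun E x * b1_fun E x / 6)
        else if i = 2 then 2 * H * (b_fun E x * b1_fun E x / 6) - H^2 * (b_fun E x * w3 x * g3 x / 3) * (x / H)
        else H^2 * (b_fun E x * w3 x * g3 x / 3) / H) = psi u i 2 * psi u i 3"
      unfolding r p using H(2) b0 by (auto simp: field_simps power2_eq_square power3_eq_cube)
  qed
  have dab: "((\<lambda>x. a1_fun E x * (b_fun E x)^2 / 27) has_field_derivative (b_fun E x)^2 * (g3 x)^2 / 9) (at x)"
  proof -
    have "((\<lambda>x. (b_fun E x)^2) has_field_derivative 2 * rho x * (b_fun E x)^2) (at x)"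
      by (rule derivative_eq_intros coef refl | simp add: power2_eq_square)+
    from DERIV_cdivide[OF DERIV_mult[OF coef(4) this]] show ?thesis
      by (rule DERIV_cong) (simp add: field_simps)
  qed
  have dh3: "((\<lambda>h. h^3) has_field_derivative 3 * H^2) (at H)"
    by (rule derivative_eq_intros refl | simp)+
  show "has_gradient P33 (\<lambda>i. psi u i 3 * psi u i 3) u"
    unfolding P33_def[abs_def]
  proof (rule has_gradient_cong[OF sep[OF dh3 dab]])
    fix i :: 3
    have 2: "1 = a1_fun E x - x * (g3 x)^2" by (simp add: a1_fun_def g2)
    have 1: "(g1 x)^2 = (x - 1) * (g3 x)^2 - a1_fun E x"
      using col(5) g2 unfolding a1_fun_def by algebra
    have p: "(E x $ i $ 3)^2 = (if i = 1 then (x - 1) * (g3 x)^2 - a1_fun E x else if i = 2 then a1_fun E x - x * (g3 x)^2 else (g3 x)^2)"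
      using exhaust_3[of i] 1 2 g2 by (elim disjE) simp_all
    have r: "psi u i 3 * psi u i 3 = H^2 * (b_fun E x)^2 * (E x $ i $ 3)^2 / 9" by (simp add: psi field_simps power2_eq_square)
    show "(if i = 1 then H^3 * ((b_fun E x)^2 * (g3 x)^2 / 9) * ((x - 1) / H) - 3 * H^2 * (a1_fun E x * (b_fun E x)^2 / 27)
        else if i = 2 then 3 * H^2 * (a1_fun E x * (b_fun E x)^2 / 27) - H^3 * ((b_fun E x)^2 * (g3 x)^2 / 9) * (x / H)
        else H^3 * ((b_fun E x)^2 * (g3 x)^2 / 9) / H) = psi u i 3 * psi u i 3"
      unfolding r p using H(2) b0 by (auto simp: field_simps power2_eq_square power3_eq_cube)
  qed
qed

lemma E_continuous: "continuous_on R (\<lambda>x. E x $ i $ j)"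
proof -
  have c: "continuous_on R f" if "\<And>x. x \<in> R \<Longrightarrow> (f has_field_derivative f' x) (at x)" for f f' :: "complex \<Rightarrow> complex"
    using that open_R by (meson DERIV_isCont continuous_at_imp_continuous_on)
  have "continuous_on R (\<lambda>x. E x $ 2 $ 3)"
    by (rule continuous_on_eq[OF continuous_on_const[of _ 1]]) (simp add: g(2))
  then have "\<forall>i j. continuous_on R (\<lambda>x. E x $ i $ j)"
    unfolding forall_3 using c[OF dw(1)] c[OF dw(2)] c[OF dw(3)] c[OF deriv_frame(1)] c[OF deriv_frame(2)]
      c[OF deriv_frame(3)] c[OF deriv_frame(4)] c[OF deriv_frame(5)] by blast
  then show ?thesis by blast
qed

lemma psi_continuous: "continuous_on S (\<lambda>u. psi u i \<alpha>)"
proof -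
  have cont: "continuous_on S F" if "\<And>u. u \<in> S \<Longrightarrow> has_gradient F (D u) u" for F D
    using that by (meson has_gradient_def has_derivative_continuous continuous_at_imp_continuous_on)
  have x: "continuous_on S x_of" and H: "continuous_on S H_of"
    using cont[OF has_gradient_x_of] cont[OF has_gradient_H_of] S_D(3) by blast+
  have Ex: "continuous_on S (\<lambda>u. E (x_of u) $ i $ j)" for i j
    using continuous_on_compose2[OF E_continuous x] S_D(1) by blast
  have f: "continuous_on S (\<lambda>u. f_fun E (x_of u) (H_of u))"
    unfolding f_fun_def b_fun_def by (intro continuous_intros Ex x H) simp
  show ?thesis
    unfolding psi_def by (cases "\<alpha> = 1"; cases "\<alpha> = 2"; simp; intro continuous_intros Ex f) (use S_D in auto)
qed

text \<open>Scaling the rows of the first column by 0, 1, x gives a vector whose expansion in the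
  frame has coefficients \<open>a\<close>, \<open>b\<close>, \<open>c\<close>, by duality of first
  and third columns. Division by \<open>f = H b / 3\<close> turns the coefficient \<open>H b\<close>
  into the constant 3, the second component of the Euler field.\<close>

lemma psi_euler:
  assumes u: "u \<in> S"
  shows "t_map E L T u $ 1 * psi u i 1 + 3 * psi u i 2 - t_map E L T u $ 3 * psi u i 3 = u $ i * psi u i 1"
proof -
  define x H where "x = x_of u" and "H = H_of u"
  note x = S_D(1)[OF u, folded x_def] and H = S_D(2,3)[OF u, folded H_def]
  note row = identities(9-14)[OF x x x x x x x] and g2 = g(2)[OF x]
  have b0: "b_fun E x \<noteq> 0" by (rule nz(4)[OF x])
  have ui: "u $ 2 = u $ 1 + H" "u $ 3 = u $ 1 + x * H"
    using H by (simp_all add: x_def H_def x_of_def H_of_def)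
  have "a_fun E x * e1 x + b_fun E x * w1 x + c_fun E x * g1 x = 0"
    "a_fun E x * e2 x + b_fun E x * w2 x + c_fun E x * E x $ 2 $ 3 = e2 x"
    "a_fun E x * e3 x + b_fun E x * w3 x + c_fun E x * g3 x = x * e3 x"
    unfolding a_fun_def b_fun_def c_fun_def g2 using row by algebra+
  then have k: "u $ 1 * E x $ i $ 1 + H * (a_fun E x * E x $ i $ 1 + b_fun E x * E x $ i $ 2 + c_fun E x * E x $ i $ 3)
     = u $ i * E x $ i $ 1"
    using exhaust_3[of i] ui by (elim disjE) (simp_all add: algebra_simps)
  have "t_map E L T u $ 1 * psi u i 1 + 3 * psi u i 2 - t_map E L T u $ 3 * psi u i 3
    = (u $ 1 * E x $ i $ 1 + H * (a_fun E x * E x $ i $ 1 + b_fun E x * E x $ i $ 2 + c_fun E x * E x $ i $ 3)) * (3 / (H * b_fun E x))"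
    using H b0 by (simp add: t_map_def vector_3 psi_def t3_fun_def f_fun_def x_def[symmetric] H_def[symmetric] field_simps power2_eq_square)
  also have "\<dots> = u $ i * psi u i 1"
    unfolding k using H b0 by (simp add: psi_def f_fun_def x_def[symmetric] H_def[symmetric])
  finally show ?thesis .
qed

definition c3 where "c3 u \<alpha> \<beta> \<gamma> = (\<Sum>i\<in>UNIV. psi u i \<alpha> * psi u i \<beta> * psi u i \<gamma> / psi u i 1)"

lemma c3_euler:
  assumes u: "u \<in> S"
  shows "t_map E L T u $ 1 * eta $ \<beta> $ \<gamma> + 3 * c3 u 2 \<beta> \<gamma> - t_map E L T u $ 3 * c3 u 3 \<beta> \<gamma>
    = (\<Sum>i\<in>UNIV. u $ i * (psi u i \<beta> * psi u i \<gamma>))"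
proof -
  have "t_map E L T u $ 1 * eta $ \<beta> $ \<gamma> + 3 * c3 u 2 \<beta> \<gamma> - t_map E L T u $ 3 * c3 u 3 \<beta> \<gamma>
    = (\<Sum>i\<in>UNIV. (t_map E L T u $ 1 * psi u i 1 + 3 * psi u i 2 - t_map E L T u $ 3 * psi u i 3)
         * (psi u i \<beta> * psi u i \<gamma> / psi u i 1))"
    unfolding psi_columns[OF u, symmetric] c3_def
    by (simp add: sum_distrib_left sum.distrib[symmetric] sum_subtractf[symmetric] psi_nonzero[OF u] algebra_simps)
  also have "\<dots> = (\<Sum>i\<in>UNIV. u $ i * (psi u i \<beta> * psi u i \<gamma>))"
    unfolding psi_euler[OF u] by (simp add: psi_nonzero[OF u])
  finally show ?thesis .
qed

text \<open>The vector u is \<open>u $ 1\<close> times (1, 1, 1) plus \<open>H\<close> times (0, 1,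
  x). The first part contributes an entry of \<open>eta\<close>, the second the coefficients
  \<open>b2\<close>, \<open>b1\<close>, \<open>a1\<close>. The factors 1, 2, 3 are the homogeneity
  weights, and they account for the denominators 6 and 27 in \<open>P23\<close> and
  \<open>P33\<close>.\<close>

lemma weighted_frame_products:
  assumes u: "u \<in> S"
  shows "(\<Sum>i\<in>UNIV. u $ i * (psi u i 2 * psi u i 2)) = P22 u"
    "(\<Sum>i\<in>UNIV. u $ i * (psi u i 2 * psi u i 3)) = 2 * P23 u"
    "(\<Sum>i\<in>UNIV. u $ i * (psi u i 3 * psi u i 3)) = 3 * P33 u"
proof -
  define x H where "x = x_of u" and "H = H_of u"
  note H = S_D(2,3)[OF u, folded H_def]
  have ui: "u $ 2 = u $ 1 + H" "u $ 3 = u $ 1 + x * H"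
    using H by (simp_all add: x_def H_def x_of_def H_of_def)
  have w: "(\<Sum>i\<in>UNIV. u $ i * q i) = u $ 1 * (\<Sum>i\<in>UNIV. q i) + H * (q 2 + x * q 3)" for q :: "3 \<Rightarrow> complex"
    by (simp add: sum_3 ui algebra_simps)
  show "(\<Sum>i\<in>UNIV. u $ i * (psi u i 2 * psi u i 2)) = P22 u"
    "(\<Sum>i\<in>UNIV. u $ i * (psi u i 2 * psi u i 3)) = 2 * P23 u"
    "(\<Sum>i\<in>UNIV. u $ i * (psi u i 3 * psi u i 3)) = 3 * P33 u"
    unfolding w psi_columns[OF u] eta_3
    by (simp_all add: psi_def P22_def P23_def P33_def b2_fun_def b1_fun_def a1_fun_def f_fun_def
        x_def[symmetric] H_def[symmetric] field_simps power2_eq_square power3_eq_cube)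
qed

text \<open>Since \<open>H^3 / f^2 = 9 H / b^2\<close>, the three summands of the bracket in F are,
  one by one, the contributions of \<open>P33\<close>, \<open>P23\<close> and
  \<open>P22 - t1\<close>; the constants 1/6 and 3/4 come from the homogeneity weights in this
  way.\<close>

lemma F_param_decomposition:
  assumes u: "u \<in> S"
  defines "t \<equiv> t_map E L T u"
  shows "F_param E L T u = 1/2 * t $ 1 * (t $ 2)^2 + 1/2 * (t $ 1)^2 * t $ 3
        + 9 * (P22 u - t $ 1) - 9/2 * (t $ 3 * P23 u) + 1/2 * ((t $ 3)^2 * P33 u)"
proof -
  define x H where "x = x_of u" and "H = H_of u"
  note x = S_D(1)[OF u, folded x_def] and H = S_D(2,3)[OF u, folded H_def]
  have b0: "b_fun E x \<noteq> 0" by (rule nz(4)[OF x])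
  have t3: "t $ 3 = - 9 * c_fun E x / (H * (b_fun E x)^2)" and t1: "t $ 1 = u $ 1 + a_fun E x * H"
    using H b0 by (simp_all add: t_def t_map_def vector_3 t3_fun_def f_fun_def x_def[symmetric] H_def[symmetric] power2_eq_square mult_ac)
  have "(1/6 * a1_fun E x * (c_fun E x)^2 + 3/4 * b_fun E x * b1_fun E x * c_fun E x
          + (b2_fun E x - a_fun E x) * (b_fun E x)^2) * (H^3 / (f_fun E x H)^2)
    = 9 * (P22 u - t $ 1) - 9/2 * (t $ 3 * P23 u) + 1/2 * ((t $ 3)^2 * P33 u)"
    unfolding t3 t1 P22_def P23_def P33_def x_def[symmetric] H_def[symmetric] f_fun_def
    using H b0 by (simp add: field_simps power2_eq_square power3_eq_cube)
  then show ?thesis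
    by (simp add: F_param_def Let_def t_def[symmetric] x_def[symmetric] H_def[symmetric])
qed

section \<open>Inverting the chart and transporting the potential to flat coordinates\<close>

lemma local_solution:
  assumes u0: "u0 \<in> S"
  obtains N W F where "open N" "u0 \<in> N" "N \<subseteq> S" "open W" "biholomorphic_C3 (t_map E L T) N W"
    "\<And>u. u \<in> N \<Longrightarrow> F (t_map E L T u) = F_param E L T u"
    "WDVV_solution 2 (vector [0, 1, 2]) (\<lambda>t. vector [t $ 1, 3, - t $ 3]) F W"
proof -
  \<comment> \<open>\<open>J\<close> is the Jacobian matrix of the chart. Its inverse
    \<open>K\<close> is explicit, because \<open>J ** K = mat 1\<close> is orthonormality of the
    columns with one index reflected by \<open>eta\<close>; no determinant has to be
    examined.\<close>
  define J :: "complex^3 \<Rightarrow> complex^3^3" where "J u = (\<chi> \<gamma> i. psi u i 1 * psi u i (4 - \<gamma>))" for u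
  define K :: "complex^3 \<Rightarrow> complex^3^3" where "K u = (\<chi> i \<gamma>. psi u i \<gamma> / psi u i 1)" for u
  have dt: "has_gradient (\<lambda>u. t_map E L T u $ \<gamma>) (\<lambda>i. J u $ \<gamma> $ i) u" if "u \<in> S" for u \<gamma>
    using gradients(1)[OF that] by (simp add: J_def)
  have cJ: "continuous_on S (\<lambda>u. J u $ \<gamma> $ i)" for \<gamma> i
    unfolding J_def by (simp, intro continuous_intros psi_continuous)
  have JK: "J u ** K u = mat 1" if u: "u \<in> S" for u
  proof -
    have "(\<Sum>i\<in>UNIV. psi u i 1 * psi u i (4 - \<gamma>) * (psi u i \<delta> / psi u i 1)) = eta $ (4 - \<gamma>) $ \<delta>" for \<gamma> \<delta>
      unfolding psi_columns[OF u, symmetric] by (simp add: psi_nonzero[OF u])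
    moreover have "\<forall>\<gamma> \<delta>. eta $ (4 - \<gamma>) $ \<delta> = (if \<gamma> = \<delta> then 1 else 0)"
      unfolding forall_3 by (simp add: eta_3)
    ultimately show ?thesis by (simp add: matrix_matrix_mult_def J_def K_def vec_eq_iff mat_def)
  qed
  obtain N W s where N: "open N" "u0 \<in> N" "N \<subseteq> S" "open W" and hom: "homeomorphism N W (t_map E L T) s"
    and ds: "\<And>t i. t \<in> W \<Longrightarrow> has_gradient (\<lambda>t. s t $ i) (\<lambda>\<gamma>. K (s t) $ i $ \<gamma>) t"
    using holomorphic_inverse_function[OF open_S u0 dt cJ JK] by metis
  have sN: "s t \<in> N" "s t \<in> S" "t_map E L T (s t) = t" if "t \<in> W" for t
    using hom N(3) that by (auto simp: homeomorphism_def)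
  have sg: "s (t_map E L T u) = u" if "u \<in> N" for u
    using hom that by (auto simp: homeomorphism_def)
  have bij: "bij_betw (t_map E L T) N W"
    using hom by (auto simp: homeomorphism_def bij_betw_def intro: inj_on_inverseI)
  have sinv: "s t = inv_into N (t_map E L T) t" if "t \<in> W" for t
    using bij sN[OF that] by (metis bij_betw_def inv_into_f_f)
  \<comment> \<open>The chain rule replaces du_i by \<open>psi i \<gamma> / psi i 1\<close>, so a
    function with gradient \<open>psi i \<alpha> * psi i \<beta>\<close> in u has the structure
    functions \<open>c3\<close> as its gradient in t.\<close>
  have dcomp: "has_gradient (\<lambda>t. P (s t)) (\<lambda>\<gamma>. c3 (s t) \<gamma> \<alpha> \<beta>) t"
    if "t \<in> W" "\<And>u. u \<in> S \<Longrightarrow> has_gradient P (\<lambda>i. psi u i \<alpha> * psi u i \<beta>) u" for P \<alpha> \<beta> t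
    by (rule has_gradient_cong[OF has_gradient_compose[OF ds[OF that(1)] that(2)[OF sN(2)[OF that(1)]]]])
       (auto simp: c3_def K_def mult_ac intro!: sum.cong)
  have bihol: "biholomorphic_C3 (t_map E L T) N W"
    unfolding biholomorphic_C3_def
  proof (intro conjI allI bij)
    fix i
    show "holomorphic_C3 (\<lambda>u. t_map E L T u $ i) N"
      using dt N(3) by (intro has_gradient_imp_holomorphic_C3) blast
    show "holomorphic_C3 (\<lambda>t. inv_into N (t_map E L T) t $ i) W"
      by (rule has_gradient_imp_holomorphic_C3, rule has_gradient_transform_open[OF ds N(4)]) (auto simp: sinv)
  qed
  have "WDVV_solution 2 (vector [0, 1, 2]) (\<lambda>t. vector [t $ 1, 3, - t $ 3]) (\<lambda>t. F_param E L T (s t)) W"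
  proof (rule WDVV_solution_from_structure_functions[where c = "\<lambda>\<alpha> \<beta> \<gamma> t. c3 (s t) \<alpha> \<beta> \<gamma>"])
    fix t \<alpha> \<beta> \<gamma> \<delta>
    show "c3 (s t) \<alpha> \<beta> \<gamma> = c3 (s t) \<beta> \<alpha> \<gamma>" "c3 (s t) \<alpha> \<beta> \<gamma> = c3 (s t) \<alpha> \<gamma> \<beta>"
      by (simp_all add: c3_def mult_ac)
    assume t: "t \<in> W"
    note u = sN(2)[OF t] and tu = sN(3)[OF t]
    show "c3 (s t) 1 \<alpha> \<beta> = eta $ \<alpha> $ \<beta>"
      unfolding psi_columns[OF u, symmetric] c3_def by (simp add: psi_nonzero[OF u])
    show "(\<Sum>\<kappa>\<in>UNIV. \<Sum>\<nu>\<in>UNIV. c3 (s t) \<alpha> \<beta> \<kappa> * eta $ \<kappa> $ \<nu> * c3 (s t) \<nu> \<gamma> \<delta>)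
      = (\<Sum>\<kappa>\<in>UNIV. \<Sum>\<nu>\<in>UNIV. c3 (s t) \<delta> \<beta> \<kappa> * eta $ \<kappa> $ \<nu> * c3 (s t) \<nu> \<gamma> \<alpha>)"
      unfolding c3_def orthonormal_frame_associativity[OF psi_columns[OF u]] by (simp only: mult_ac)
    show "has_gradient (\<lambda>t. P22 (s t)) (\<lambda>\<alpha>. c3 (s t) \<alpha> 2 2) t"
      "has_gradient (\<lambda>t. P23 (s t)) (\<lambda>\<alpha>. c3 (s t) \<alpha> 2 3) t"
      "has_gradient (\<lambda>t. P33 (s t)) (\<lambda>\<alpha>. c3 (s t) \<alpha> 3 3) t"
      by (rule dcomp[OF t]; rule gradients; assumption)+
    note eu = c3_euler[OF u, unfolded tu]
    show "t $ 1 + 3 * c3 (s t) 2 2 2 - t $ 3 * c3 (s t) 3 2 2 = P22 (s t)"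
      using eu[of 2 2] weighted_frame_products(1)[OF u] by (simp add: eta_3)
    show "3 * c3 (s t) 2 2 3 - t $ 3 * c3 (s t) 3 2 3 = 2 * P23 (s t)"
      using eu[of 2 3] weighted_frame_products(2)[OF u] by (simp add: eta_3)
    show "3 * c3 (s t) 2 3 3 - t $ 3 * c3 (s t) 3 3 3 = 3 * P33 (s t)"
      using eu[of 3 3] weighted_frame_products(3)[OF u] by (simp add: eta_3)
    show "F_param E L T (s t) = 1/2 * t $ 1 * (t $ 2)^2 + 1/2 * (t $ 1)^2 * t $ 3
        + 9 * (P22 (s t) - t $ 1) - 9/2 * (t $ 3 * P23 (s t)) + 1/2 * ((t $ 3)^2 * P33 (s t))"
      using F_param_decomposition[OF u] unfolding tu .
  qed (rule N(4))
  with that[OF N bihol, of "\<lambda>t. F_param E L T (s t)"] sg show thesis by simp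
qed

end

section \<open>The invariant of the chart\<close>

lemma t3_fun_eq: "H \<noteq> 0 \<Longrightarrow> t3_fun E x H = - 9 * (c_fun E x / (b_fun E x)^2) * (1 / H)"
  by (simp add: t3_fun_def f_fun_def power2_eq_square mult_ac)

text \<open>The term \<open>3 * L H\<close> contributes \<open>H^3\<close> to the exponential, and
  the cube of \<open>t3\<close> contributes \<open>1 / H^3\<close>.\<close>

lemma exp_t2_t3_cubed:
  assumes "log_branch L \<Lambda>" "H \<in> \<Lambda>" "b_fun E x \<noteq> 0"
  shows "exp (t2_fun L T x H) * (t3_fun E x H)^3 = exp (3 * T x) * (- 9 * (c_fun E x / (b_fun E x)^2))^3"
proof -
  define q where "q = - 9 * (c_fun E x / (b_fun E x)^2)"
  have "exp (L H) = H" using assms by (auto simp: log_branch_def)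
  moreover from this have H: "H \<noteq> 0" using exp_not_eq_zero by metis
  ultimately have "exp (3 * L H + 3 * T x) = H^3 * exp (3 * T x)"
    by (simp add: exp_add exp_of_nat_mult[of 3, simplified])
  moreover have "t3_fun E x H = q * (1 / H)" unfolding q_def by (rule t3_fun_eq[OF H])
  ultimately show ?thesis
    using H unfolding q_def[symmetric] by (simp add: t2_fun_def power_divide)
qed

context PVI_chart
begin

definition invariant where "invariant x = exp (3 * T x) * (- 9 * (c_fun E x / (b_fun E x)^2))^3"

text \<open>In the logarithmic derivative the combination \<open>w3 c - e3 b\<close> appears. Its
  terms with the weight x cancel, leaving \<open>e2\<close> times a component of the first column's
  cross product with \<open>w\<close>, and the eigenvector relation turns that component into
  \<open>\<i> * e1\<close>.\<close>

lemma has_field_derivative_invariant: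
  assumes x: "x \<in> R" and c0: "c_fun E x \<noteq> 0"
  shows "(invariant has_field_derivative
    invariant x * (3 * \<i> * e1 x * e2 x * e3 x / (b_fun E x * c_fun E x))) (at x)"
    and "invariant x * (3 * \<i> * e1 x * e2 x * e3 x / (b_fun E x * c_fun E x)) \<noteq> 0"
proof -
  note coef = deriv_coefficients[OF x] and b0 = nz(4)[OF x]
  note dq = deriv_c_over_b_squared[OF x]
  define q where "q = - 9 * (c_fun E x / (b_fun E x)^2)"
  have "((\<lambda>x. exp (3 * T x)) has_field_derivative exp (3 * T x) * (3 * (e3 x * w3 x / b_fun E x))) (at x)"
    by (rule derivative_eq_intros dT[OF x] refl)+ simp
  from DERIV_mult[OF this DERIV_power[OF dq, of 3]]
  have "(invariant has_field_derivative exp (3 * T x) * (3 * (e3 x * w3 x / b_fun E x)) * q^3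
      + 3 * q^2 * (9 * (e3 x)^2 / (b_fun E x)^2) * exp (3 * T x)) (at x)"
    unfolding invariant_def[abs_def] q_def by (simp add: mult_ac)
  moreover have "exp (3 * T x) * (3 * (e3 x * w3 x / b_fun E x)) * q^3
      + 3 * q^2 * (9 * (e3 x)^2 / (b_fun E x)^2) * exp (3 * T x)
    = invariant x * (3 * \<i> * e1 x * e2 x * e3 x / (b_fun E x * c_fun E x))"
  proof -
    have "w3 x * c_fun E x - e3 x * b_fun E x = e2 x * (e2 x * w3 x - e3 x * w2 x)"
      unfolding c_fun_def b_fun_def by algebra
    also have "\<dots> = \<i> * e1 x * e2 x" using identities(2)[OF x x x x x x x] by simp
    finally have k: "\<i> * e1 x * e2 x = w3 x * c_fun E x - e3 x * b_fun E x" ..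
    have r: "9 * (e3 x)^2 / (b_fun E x)^2 = - q * (e3 x)^2 / c_fun E x" using c0 by (simp add: q_def)
    have "exp (3 * T x) * (3 * (e3 x * w3 x / b_fun E x)) * q^3
      + 3 * q^2 * (- q * (e3 x)^2 / c_fun E x) * exp (3 * T x)
      = exp (3 * T x) * q^3 * (3 * e3 x * (w3 x * c_fun E x - e3 x * b_fun E x) / (b_fun E x * c_fun E x))"
      using b0 c0 by (simp add: field_simps power2_eq_square power3_eq_cube)
    then show ?thesis unfolding r k[symmetric] by (simp add: invariant_def q_def mult_ac)
  qed
  ultimately show "(invariant has_field_derivative
    invariant x * (3 * \<i> * e1 x * e2 x * e3 x / (b_fun E x * c_fun E x))) (at x)" by simp
  show "invariant x * (3 * \<i> * e1 x * e2 x * e3 x / (b_fun E x * c_fun E x)) \<noteq> 0"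
    using nz[OF x] c0 by (simp add: invariant_def)
qed

lemma invariant_t_map:
  assumes u: "u \<in> S"
  shows "exp (t_map E L T u $ 2) * (t_map E L T u $ 3)^3 = invariant (x_of u)"
  using exp_t2_t3_cubed[OF log S_D(2)[OF u] nz(4)[OF S_D(1)[OF u]]]
  by (simp add: t_map_def invariant_def)

lemma potential_from_invariant:
  assumes c0: "\<And>x. x \<in> R \<Longrightarrow> c_fun E x \<noteq> 0" and inj: "inj_on invariant R"
  obtains \<phi> where "\<phi> holomorphic_on invariant ` R"
    "\<And>u. u \<in> S \<Longrightarrow> t_map E L T u $ 3 \<noteq> 0"
    "\<And>u. u \<in> S \<Longrightarrow> F_param E L T u = 1/2 * t_map E L T u $ 1 * (t_map E L T u $ 2)^2
        + 1/2 * (t_map E L T u $ 1)^2 * t_map E L T u $ 3 + 1 / t_map E L T u $ 3 * \<phi> (invariant (x_of u))"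
proof -
  \<comment> \<open>\<open>\<kappa>\<close> is \<open>t3\<close> times the part of F beyond the
    cubic terms. The powers of H cancel, and -81 is -9 from \<open>t3\<close> times 9 from
    \<open>H^3 / f^2 = 9 H / b^2\<close>. Composing with the inverse of the invariant gives the
    required function.\<close>
  define \<kappa> where "\<kappa> x = - 81 * c_fun E x * (1/6 * a1_fun E x * (c_fun E x)^2 + 3/4 * b_fun E x * b1_fun E x * c_fun E x
          + (b2_fun E x - a_fun E x) * (b_fun E x)^2) / (b_fun E x)^4" for x
  have hol: "f holomorphic_on R" if "\<And>x. x \<in> R \<Longrightarrow> (f has_field_derivative f' x) (at x)" for f f' :: "complex \<Rightarrow> complex"
    using that open_R by (meson holomorphic_onI field_differentiable_def field_differentiable_at_within)
  note hols = hol[OF deriv_coefficients(1)] hol[OF deriv_coefficients(2)] hol[OF deriv_coefficients(3)]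
    hol[OF deriv_coefficients(4)] hol[OF deriv_coefficients(5)] hol[OF deriv_coefficients(6)]
  have \<kappa>: "\<kappa> holomorphic_on R"
    unfolding \<kappa>_def by (intro holomorphic_intros hols) (use nz(4) in auto)
  have "invariant holomorphic_on R"
    using hol[OF has_field_derivative_invariant(1)] c0 by blast
  then obtain h where h: "h holomorphic_on invariant ` R" "\<And>x. x \<in> R \<Longrightarrow> h (invariant x) = x"
    using holomorphic_has_inverse[OF _ open_R inj] by metis
  show thesis
  proof (rule that[of "\<kappa> \<circ> h"])
    show "\<kappa> \<circ> h holomorphic_on invariant ` R"
      by (rule holomorphic_on_compose_gen[OF h(1) \<kappa>]) (use h(2) in auto)
    fix u assume u: "u \<in> S"
    define x H where "x = x_of u" and "H = H_of u"
    note x = S_D(1)[OF u, folded x_def] and H = S_D(2,3)[OF u, folded H_def]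
    note b0 = nz(4)[OF x] and c0 = c0[OF x]
    have t3: "t_map E L T u $ 3 = - 9 * c_fun E x / (H * (b_fun E x)^2)"
      using H b0 by (simp add: t_map_def vector_3 t3_fun_def f_fun_def x_def[symmetric] H_def[symmetric] power2_eq_square mult_ac)
    then show "t_map E L T u $ 3 \<noteq> 0" using H b0 c0 by simp
    have hx: "(\<kappa> \<circ> h) (invariant (x_of u)) = \<kappa> x" using h(2)[OF x] by (simp add: x_def)
    have "z * (H^3 / (f_fun E x H)^2) = 1 / (- 9 * c_fun E x / (H * (b_fun E x)^2)) * (- 81 * c_fun E x * z / (b_fun E x)^4)" for z
      unfolding f_fun_def using H b0 c0 by (simp add: field_simps power2_eq_square power3_eq_cube power4_eq_xxxx)
    then have G: "z * (H^3 / (f_fun E x H)^2) = 1 / t_map E L T u $ 3 * (- 81 * c_fun E x * z / (b_fun E x)^4)" for z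
      unfolding t3 .
    show "F_param E L T u = 1/2 * t_map E L T u $ 1 * (t_map E L T u $ 2)^2
        + 1/2 * (t_map E L T u $ 1)^2 * t_map E L T u $ 3 + 1 / t_map E L T u $ 3 * (\<kappa> \<circ> h) (invariant (x_of u))"
      unfolding hx unfolding \<kappa>_def F_param_def Let_def x_def[symmetric] H_def[symmetric] G ..
  qed
qed

end

lemma E_matrix_entries:
  "E_matrix (-1) v1 v2 v3 $ 1 $ 1 = (v1 * v2 + v3) / 2" "E_matrix (-1) v1 v2 v3 $ 1 $ 2 = \<i> * v1"
  "E_matrix (-1) v1 v2 v3 $ 1 $ 3 = - (v1 * v2 - v3) / (v1^2 + v3^2)"
  "E_matrix (-1) v1 v2 v3 $ 2 $ 1 = - (v1^2 + v3^2) / 2" "E_matrix (-1) v1 v2 v3 $ 2 $ 2 = \<i> * v2"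
  "E_matrix (-1) v1 v2 v3 $ 2 $ 3 = 1"
  "E_matrix (-1) v1 v2 v3 $ 3 $ 1 = (v2 * v3 - v1) / 2" "E_matrix (-1) v1 v2 v3 $ 3 $ 2 = \<i> * v3"
  "E_matrix (-1) v1 v2 v3 $ 3 $ 3 = - (v2 * v3 + v1) / (v1^2 + v3^2)"
  by (simp_all add: E_matrix_def vector_3 divide_i)

section \<open>The parametric solution\<close>

text \<open>On \<open>V\<close> all relations come from the Omega system and the definition of
  \<open>E\<close>. With denominators cleared, both sides are holomorphic on the connected set
  \<open>U\<close>, so agreement on the nonempty open \<open>V\<close> extends to \<open>U\<close>.
  The clearing matters for \<open>E13\<close>, \<open>E33\<close> and \<open>T\<close>, whose
  denominators on \<open>V\<close> may vanish elsewhere in \<open>U\<close>. Division is resumed on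
  \<open>R\<close>, where the relevant factors are nonzero.\<close>

lemma PVI_frame_of_solution:
  assumes dom: "open U" "connected U" "0 \<notin> U" "1 \<notin> U" "open V" "V \<noteq> {}" "V \<subseteq> U"
    and y: "PVI_solution (-1) y V"
    and roots: "sqrt_branch sx (\<lambda>x. x) V" "sqrt_branch s1x (\<lambda>x. 1 - x) V"
      "sqrt_branch sy y V" "sqrt_branch sy1 (\<lambda>x. y x - 1) V" "sqrt_branch syx (\<lambda>x. y x - x) V"
    and E_def_V: "\<And>x. x \<in> V \<Longrightarrow>
        (Omega1 (-1) y sy1 syx sx x)^2 + (Omega3 (-1) y sy sy1 sx s1x x)^2 \<noteq> 0 \<and>
        E x = E_matrix (-1) (Omega1 (-1) y sy1 syx sx x) (Omega2 (-1) y sy syx s1x x)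
                (Omega3 (-1) y sy sy1 sx s1x x)"
    and E_hol: "\<And>i j. (\<lambda>x. E x $ i $ j) holomorphic_on U"
    and T_def_V: "\<And>x. x \<in> V \<Longrightarrow>
        E x $ 3 $ 1 * E x $ 3 $ 2 \<noteq> 0 \<and>
        x + E x $ 2 $ 1 * E x $ 2 $ 2 / (E x $ 3 $ 1 * E x $ 3 $ 2) \<noteq> 0 \<and>
        deriv T x = 1 / (x + E x $ 2 $ 1 * E x $ 2 $ 2 / (E x $ 3 $ 1 * E x $ 3 $ 2))"
    and T_hol: "T holomorphic_on U"
    and R: "open R" "R \<subseteq> U" "\<And>x. x \<in> R \<Longrightarrow> E x $ 1 $ 1 * E x $ 2 $ 1 * E x $ 3 $ 1 * b_fun E x \<noteq> 0"
  shows "PVI_frame E T R"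
proof -
  define O1 O2 O3 where "O1 = Omega1 (-1) y sy1 syx sx" and "O2 = Omega2 (-1) y sy syx s1x"
    and "O3 = Omega3 (-1) y sy sy1 sx s1x"
  have ext: "\<forall>z\<in>U. f z = h z" if "f holomorphic_on U" "h holomorphic_on U" "\<And>z. z \<in> V \<Longrightarrow> f z = h z" for f h
    using analytic_continuation_open[OF dom(5,1,6,2,7) that] by blast
  note hol = holomorphic_intros E_hol holomorphic_deriv[OF E_hol dom(1)] holomorphic_deriv[OF T_hol dom(1)]
  have EV: "E x = E_matrix (-1) (O1 x) (O2 x) (O3 x)" "(O1 x)^2 + (O3 x)^2 \<noteq> 0" if "x \<in> V" for x
    using E_def_V[OF that] by (simp_all add: O1_def O2_def O3_def)
  have i2: "\<i> * (\<i> * z) = - z" for z by (simp flip: mult.assoc)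
  have dO: "(O1 has_field_derivative O2 x * O3 x / x) (at x)"
    "(O2 has_field_derivative O1 x * O3 x / (1 - x)) (at x)"
    "(O3 has_field_derivative O1 x * O2 x / (x * (x - 1))) (at x)"
    "(O1 x)^2 + (O2 x)^2 + (O3 x)^2 = -1" if "x \<in> V" for x
    using Omega_system[OF dom(5) that y roots] by (simp_all add: O1_def O2_def O3_def)
  have ent: "E x $ 1 $ 1 = (O1 x * O2 x + O3 x) / 2" "E x $ 1 $ 2 = \<i> * O1 x"
    "E x $ 1 $ 3 = - (O1 x * O2 x - O3 x) / ((O1 x)^2 + (O3 x)^2)"
    "E x $ 2 $ 1 = - ((O1 x)^2 + (O3 x)^2) / 2" "E x $ 2 $ 2 = \<i> * O2 x" "E x $ 2 $ 3 = 1"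
    "E x $ 3 $ 1 = (O2 x * O3 x - O1 x) / 2" "E x $ 3 $ 2 = \<i> * O3 x"
    "E x $ 3 $ 3 = - (O2 x * O3 x + O1 x) / ((O1 x)^2 + (O3 x)^2)" if "x \<in> V" for x
    unfolding EV(1)[OF that] E_matrix_entries by (rule refl)+
  have dE: "deriv (\<lambda>x. E x $ i $ 2) x = \<i> * d" if "x \<in> V" "(f has_field_derivative d) (at x)"
    "\<And>z. z \<in> V \<Longrightarrow> E z $ i $ 2 = \<i> * f z" for i f d x
    by (rule DERIV_imp_deriv[OF has_field_derivative_transform_within_open[OF DERIV_cmult[OF that(2)] dom(5) that(1)]])
       (use that(3) in simp)
  have nz01: "x \<noteq> 0" "x \<noteq> 1" if "x \<in> V" for x using that dom by auto
  have w1: "\<forall>x\<in>U. x * deriv (\<lambda>x. E x $ 1 $ 2) x = - \<i> * E x $ 2 $ 2 * E x $ 3 $ 2"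
  proof (rule ext)
    fix x assume x: "x \<in> V"
    show "x * deriv (\<lambda>x. E x $ 1 $ 2) x = - \<i> * E x $ 2 $ 2 * E x $ 3 $ 2"
      using dE[OF x dO(1)[OF x] ent(2)] nz01[OF x] by (simp add: ent[OF x] i2 mult_ac)
  qed (intro hol)+
  have w2: "\<forall>x\<in>U. (1 - x) * deriv (\<lambda>x. E x $ 2 $ 2) x = - \<i> * E x $ 1 $ 2 * E x $ 3 $ 2"
  proof (rule ext)
    fix x assume x: "x \<in> V"
    show "(1 - x) * deriv (\<lambda>x. E x $ 2 $ 2) x = - \<i> * E x $ 1 $ 2 * E x $ 3 $ 2"
      using dE[OF x dO(2)[OF x] ent(5)] nz01[OF x] by (simp add: ent[OF x] i2 mult_ac)
  qed (intro hol)+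
  have w3: "\<forall>x\<in>U. (x * (1 - x)) * deriv (\<lambda>x. E x $ 3 $ 2) x = \<i> * E x $ 1 $ 2 * E x $ 2 $ 2"
  proof (rule ext)
    fix x assume x: "x \<in> V"
    have "(x * (1 - x)) * (z / (x * (x - 1))) = - z" for z
      using nz01[OF x] by (simp add: field_simps)
    from this[of "\<i> * (O1 x * O2 x)"] show "(x * (1 - x)) * deriv (\<lambda>x. E x $ 3 $ 2) x = \<i> * E x $ 1 $ 2 * E x $ 2 $ 2"
      using dE[OF x dO(3)[OF x] ent(8)] by (simp add: ent[OF x] i2 mult.assoc)
  qed (intro hol)+
  have norm: "\<forall>x\<in>U. (E x $ 1 $ 2)^2 + (E x $ 2 $ 2)^2 + (E x $ 3 $ 2)^2 = 1"
  proof (rule ext)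
    fix x assume x: "x \<in> V"
    show "(E x $ 1 $ 2)^2 + (E x $ 2 $ 2)^2 + (E x $ 3 $ 2)^2 = 1"
      using dO(4)[OF x] by (simp add: ent[OF x] power_mult_distrib) algebra
  qed (intro hol)+
  have e: "\<forall>x\<in>U. 2 * E x $ 1 $ 1 = - (E x $ 1 $ 2 * E x $ 2 $ 2 + \<i> * E x $ 3 $ 2)"
    "\<forall>x\<in>U. 2 * E x $ 2 $ 1 = (E x $ 1 $ 2)^2 + (E x $ 3 $ 2)^2"
    "\<forall>x\<in>U. 2 * E x $ 3 $ 1 = \<i> * E x $ 1 $ 2 - E x $ 2 $ 2 * E x $ 3 $ 2"
    by (rule ext; (intro hol; fail)?; simp add: ent power_mult_distrib i2 field_simps)+
  have g: "\<forall>x\<in>U. 2 * E x $ 2 $ 1 * E x $ 1 $ 3 = \<i> * E x $ 3 $ 2 - E x $ 1 $ 2 * E x $ 2 $ 2"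
    "\<forall>x\<in>U. E x $ 2 $ 3 = 1"
    "\<forall>x\<in>U. 2 * E x $ 2 $ 1 * E x $ 3 $ 3 = - (\<i> * E x $ 1 $ 2 + E x $ 2 $ 2 * E x $ 3 $ 2)"
  proof -
    have q: "2 * (- s / 2) * (- r / s) = r" if "s \<noteq> 0" for r s :: complex using that by simp
    show "\<forall>x\<in>U. 2 * E x $ 2 $ 1 * E x $ 1 $ 3 = \<i> * E x $ 3 $ 2 - E x $ 1 $ 2 * E x $ 2 $ 2"
      by (rule ext, (intro hol)+) (simp only: ent q[OF EV(2)], simp add: i2 algebra_simps)
    show "\<forall>x\<in>U. 2 * E x $ 2 $ 1 * E x $ 3 $ 3 = - (\<i> * E x $ 1 $ 2 + E x $ 2 $ 2 * E x $ 3 $ 2)"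
      by (rule ext, (intro hol)+) (simp only: ent q[OF EV(2)], simp add: i2 algebra_simps)
    show "\<forall>x\<in>U. E x $ 2 $ 3 = 1" by (rule ext, (intro hol)+) (simp add: ent)
  qed
  \<comment> \<open>Multiplying the integrand through by \<open>E31 * E32\<close> gives
    \<open>E31 * E32 / b\<close>; written as a product this remains meaningful at zeros of
    \<open>E32\<close> and of \<open>b\<close>.\<close>
  have T: "\<forall>x\<in>U. deriv T x * b_fun E x = E x $ 3 $ 1 * E x $ 3 $ 2"
  proof (rule ext)
    show "(\<lambda>x. deriv T x * b_fun E x) holomorphic_on U" unfolding b_fun_def by (intro hol)
    fix x assume x: "x \<in> V"
    define r where "r = E x $ 3 $ 1 * E x $ 3 $ 2"
    have "r \<noteq> 0" "x + E x $ 2 $ 1 * E x $ 2 $ 2 / r \<noteq> 0" "deriv T x = 1 / (x + E x $ 2 $ 1 * E x $ 2 $ 2 / r)"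
      using T_def_V[OF x] by (auto simp: r_def)
    moreover have "b_fun E x = r * (x + E x $ 2 $ 1 * E x $ 2 $ 2 / r)"
      using \<open>r \<noteq> 0\<close> by (simp add: b_fun_def r_def distrib_left mult_ac)
    ultimately show "deriv T x * b_fun E x = E x $ 3 $ 1 * E x $ 3 $ 2"
      by (simp add: r_def[symmetric])
  qed (intro hol)+
  have RU: "x \<in> U" "x \<noteq> 0" "x \<noteq> 1" if "x \<in> R" for x using that R dom by auto
  have der: "(f has_field_derivative d) (at x)" if "f holomorphic_on U" "x \<in> R" "k * deriv f x = a" "d = a / k" "k \<noteq> 0"
    for f d x k a
    using holomorphic_derivI[OF that(1) dom(1) RU(1)[OF that(2)]] that(3-5) by auto
  show ?thesis
  proof
    fix x assume x: "x \<in> R"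
    note xU = RU[OF x]
    show "((\<lambda>x. E x $ 1 $ 2) has_field_derivative - \<i> * E x $ 2 $ 2 * E x $ 3 $ 2 / x) (at x)"
      by (rule der[OF E_hol x w1[rule_format, OF xU(1)] refl xU(2)])
    show "((\<lambda>x. E x $ 2 $ 2) has_field_derivative - \<i> * E x $ 1 $ 2 * E x $ 3 $ 2 / (1 - x)) (at x)"
      by (rule der[OF E_hol x w2[rule_format, OF xU(1)] refl]) (use xU in simp)
    show "((\<lambda>x. E x $ 3 $ 2) has_field_derivative \<i> * E x $ 1 $ 2 * E x $ 2 $ 2 / (x * (1 - x))) (at x)"
      by (rule der[OF E_hol x w3[rule_format, OF xU(1)] refl]) (use xU in simp)
    show "(T has_field_derivative E x $ 3 $ 1 * E x $ 3 $ 2 / b_fun E x) (at x)"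
      by (rule der[OF T_hol x _ refl, where k = "b_fun E x"]) (use R(3)[OF x] T xU(1) in \<open>auto simp: mult.commute\<close>)
    show "E x $ 1 $ 1 \<noteq> 0" "E x $ 2 $ 1 \<noteq> 0" "E x $ 3 $ 1 \<noteq> 0" "b_fun E x \<noteq> 0"
      using R(3)[OF x] by auto
  qed (use R dom RU norm e g in \<open>blast+\<close>)
qed

theorem mainTheorem5:
  fixes \<mu> :: complex
    and y sx s1x sy sy1 syx T L :: "complex \<Rightarrow> complex"
    and E :: "complex \<Rightarrow> complex^3^3"
    and U V \<Lambda> :: "complex set"
  assumes mu: "\<mu> = -1"
    and dom: "open U" "connected U" "0 \<notin> U" "1 \<notin> U" "open V" "V \<noteq> {}" "V \<subseteq> U"
    and y: "PVI_solution \<mu> y V"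
    and roots: "sqrt_branch sx (\<lambda>x. x) V" "sqrt_branch s1x (\<lambda>x. 1 - x) V"
      "sqrt_branch sy y V" "sqrt_branch sy1 (\<lambda>x. y x - 1) V" "sqrt_branch syx (\<lambda>x. y x - x) V"
    and E_def_V: "\<And>x. x \<in> V \<Longrightarrow>
        (Omega1 \<mu> y sy1 syx sx x)^2 + (Omega3 \<mu> y sy sy1 sx s1x x)^2 \<noteq> 0 \<and>
        E x = E_matrix \<mu> (Omega1 \<mu> y sy1 syx sx x) (Omega2 \<mu> y sy syx s1x x)
                (Omega3 \<mu> y sy sy1 sx s1x x)"
    and E_hol: "\<And>i j. (\<lambda>x. E x $ i $ j) holomorphic_on U"
    and T_def_V: "\<And>x. x \<in> V \<Longrightarrow>
        E x $ 3 $ 1 * E x $ 3 $ 2 \<noteq> 0 \<and>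
        x + E x $ 2 $ 1 * E x $ 2 $ 2 / (E x $ 3 $ 1 * E x $ 3 $ 2) \<noteq> 0 \<and>
        deriv T x = 1 / (x + E x $ 2 $ 1 * E x $ 2 $ 2 / (E x $ 3 $ 1 * E x $ 3 $ 2))"
    and T_hol: "T holomorphic_on U"
    and log: "open \<Lambda>" "log_branch L \<Lambda>"
  shows
    "(\<forall>x\<in>U. \<forall>H\<in>\<Lambda>. b_fun E x \<noteq> 0 \<longrightarrow>
        t3_fun E x H = - 9 * (c_fun E x / (b_fun E x)^2) * (1 / H)) \<and>
     (\<forall>x\<in>U. \<forall>H\<in>\<Lambda>. \<forall>H'\<in>\<Lambda>. b_fun E x \<noteq> 0 \<longrightarrow>
        exp (t2_fun L T x H) * (t3_fun E x H)^3 = exp (t2_fun L T x H') * (t3_fun E x H')^3) \<and>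
     (\<forall>u0 \<in> u_domain E U \<Lambda>.
        E (x_of u0) $ 1 $ 1 * E (x_of u0) $ 2 $ 1 * E (x_of u0) $ 3 $ 1 \<noteq> 0 \<longrightarrow>
        (\<exists>N W F.
           open N \<and> u0 \<in> N \<and> N \<subseteq> u_domain E U \<Lambda> \<and> open W \<and>
           biholomorphic_C3 (t_map E L T) N W \<and>
           (\<forall>u\<in>N. F (t_map E L T u) = F_param E L T u) \<and>
           WDVV_solution 2 (vector [0, 1, 2]) (\<lambda>t. vector [t $ 1, 3, - t $ 3]) F W \<and>
           (c_fun E (x_of u0) \<noteq> 0 \<longrightarrow>
             (\<exists>\<phi>. \<phi> holomorphic_on ((\<lambda>t. exp (t $ 2) * (t $ 3)^3) ` W) \<and>
                (\<forall>t\<in>W. t $ 3 \<noteq> 0 \<and>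
                   F t = 1/2 * t $ 1 * (t $ 2)^2 + 1/2 * (t $ 1)^2 * t $ 3
                         + 1 / (t $ 3) * \<phi> (exp (t $ 2) * (t $ 3)^3))))))"
proof (intro conjI ballI impI)
  fix x H assume "H \<in> \<Lambda>"
  then have "H \<noteq> 0" by (rule log_branch_has_field_derivative(2)[OF log(2,1)])
  then show "t3_fun E x H = - 9 * (c_fun E x / (b_fun E x)^2) * (1 / H)" by (rule t3_fun_eq)
next
  fix x H H' assume "H \<in> \<Lambda>" "H' \<in> \<Lambda>" and b0: "b_fun E x \<noteq> 0"
  then show "exp (t2_fun L T x H) * (t3_fun E x H)^3 = exp (t2_fun L T x H') * (t3_fun E x H')^3"
    using exp_t2_t3_cubed[OF log(2) _ b0] by simp
next
  fix u0 assume u0: "u0 \<in> u_domain E U \<Lambda>" and gen: "E (x_of u0) $ 1 $ 1 * E (x_of u0) $ 2 $ 1 * E (x_of u0) $ 3 $ 1 \<noteq> 0"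
  define R0 where "R0 = {x \<in> U. E x $ 1 $ 1 * E x $ 2 $ 1 * E x $ 3 $ 1 * b_fun E x \<noteq> 0}"
  have open_nz: "open {x \<in> U. f x \<noteq> 0}" if "f holomorphic_on U" for f :: "complex \<Rightarrow> complex"
  proof -
    have "open (U \<inter> f -` (- {0}))"
      by (rule continuous_open_preimage[OF holomorphic_on_imp_continuous_on[OF that] dom(1)]) auto
    moreover have "U \<inter> f -` (- {0}) = {x \<in> U. f x \<noteq> 0}" by auto
    ultimately show ?thesis by simp
  qed
  have bc: "b_fun E holomorphic_on U" "c_fun E holomorphic_on U"
    unfolding b_fun_def[abs_def] c_fun_def[abs_def] by (intro holomorphic_intros E_hol)+
  have R0: "open R0" unfolding R0_def by (rule open_nz) (intro holomorphic_intros E_hol bc)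
  have x0: "x_of u0 \<in> R0" "H_of u0 \<in> \<Lambda>" using u0 gen by (auto simp: u_domain_def R0_def)
  \<comment> \<open>The subset is left open because two charts are used: one on \<open>R0\<close>,
    to differentiate the invariant, and one on the smaller set on which the final neighbourhood is
    built.\<close>
  have chart: "PVI_chart E T R L \<Lambda>" if "open R" "R \<subseteq> R0" for R
  proof -
    have "PVI_frame E T R"
      by (rule PVI_frame_of_solution[OF dom y[unfolded mu] roots E_def_V[unfolded mu] E_hol T_def_V T_hol that(1)])
        (use that(2) in \<open>auto simp: R0_def\<close>)
    then show ?thesis using log by (simp add: PVI_chart_def PVI_chart_axioms_def)
  qed
  \<comment> \<open>If \<open>c\<close> vanishes at the point, then so does \<open>t3\<close> and no
    representation by \<open>\<phi>\<close> is claimed, so all of \<open>R0\<close> serves.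
    Otherwise the shrinking to a ball on which \<open>c\<close> has no zero and the invariant is
    injective must precede the choice of \<open>N\<close> and \<open>W\<close>, so that one
    \<open>\<phi>\<close> serves on all of \<open>W\<close>.\<close>
  obtain R where R: "open R" "R \<subseteq> R0" "x_of u0 \<in> R"
    and Rc: "c_fun E (x_of u0) \<noteq> 0 \<Longrightarrow> (\<forall>x\<in>R. c_fun E x \<noteq> 0) \<and> inj_on (PVI_chart.invariant E T) R"
  proof (cases "c_fun E (x_of u0) = 0")
    case True
    then show thesis using that[OF R0 order_refl x0(1)] by blast
  next
    case False
    interpret C: PVI_chart E T R0 L \<Lambda> by (rule chart[OF R0 order_refl])
    define R1 where "R1 = R0 \<inter> {x \<in> U. c_fun E x \<noteq> 0}"
    have R1: "open R1" "x_of u0 \<in> R1" unfolding R1_def using R0 open_nz[OF bc(2)] x0 False by (auto simp: R0_def)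
    have hol: "C.invariant holomorphic_on R1"
      using C.has_field_derivative_invariant(1) R1(1)
      by (auto simp: R1_def holomorphic_on_open)
    have "deriv C.invariant (x_of u0) \<noteq> 0"
      using C.has_field_derivative_invariant[OF x0(1) False] DERIV_imp_deriv by metis
    then obtain r where "r > 0" "ball (x_of u0) r \<subseteq> R1" "inj_on C.invariant (ball (x_of u0) r)"
      using has_complex_derivative_locally_injective[OF hol R1(2,1)] by blast
    then show thesis by (intro that[of "ball (x_of u0) r"]) (auto simp: R1_def)
  qed
  interpret C: PVI_chart E T R L \<Lambda> by (rule chart[OF R(1,2)])
  have S: "u0 \<in> C.S" using R(3) x0(2) by (simp add: C.S_def)
  have S_sub: "C.S \<subseteq> u_domain E U \<Lambda>"
  proof
    fix u assume u: "u \<in> C.S"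
    have "x_of u \<in> U" "b_fun E (x_of u) \<noteq> 0" using C.S_D(1)[OF u] R(2) by (auto simp: R0_def)
    moreover from this have "x_of u \<noteq> 0" "x_of u \<noteq> 1" using dom by auto
    ultimately show "u \<in> u_domain E U \<Lambda>"
      using C.S_D(2,3)[OF u] by (auto simp: u_domain_def x_of_def H_of_def)
  qed
  obtain N W F where N: "open N" "u0 \<in> N" "N \<subseteq> C.S" "open W" and bij: "biholomorphic_C3 (t_map E L T) N W"
    and F: "\<And>u. u \<in> N \<Longrightarrow> F (t_map E L T u) = F_param E L T u"
    and W: "WDVV_solution 2 (vector [0, 1, 2]) (\<lambda>t. vector [t $ 1, 3, - t $ 3]) F W"
    using C.local_solution[OF S] by blast
  have img: "W = t_map E L T ` N" using bij by (simp add: biholomorphic_C3_def bij_betw_def)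
  have \<phi>: "\<exists>\<phi>. \<phi> holomorphic_on ((\<lambda>t. exp (t $ 2) * (t $ 3)^3) ` W) \<and>
                (\<forall>t\<in>W. t $ 3 \<noteq> 0 \<and>
                   F t = 1/2 * t $ 1 * (t $ 2)^2 + 1/2 * (t $ 1)^2 * t $ 3
                         + 1 / (t $ 3) * \<phi> (exp (t $ 2) * (t $ 3)^3))" if c0: "c_fun E (x_of u0) \<noteq> 0"
  proof -
    obtain \<phi> where \<phi>: "\<phi> holomorphic_on C.invariant ` R" "\<And>u. u \<in> C.S \<Longrightarrow> t_map E L T u $ 3 \<noteq> 0"
      "\<And>u. u \<in> C.S \<Longrightarrow> F_param E L T u = 1/2 * t_map E L T u $ 1 * (t_map E L T u $ 2)^2
        + 1/2 * (t_map E L T u $ 1)^2 * t_map E L T u $ 3 + 1 / t_map E L T u $ 3 * \<phi> (C.invariant (x_of u))"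
      using C.potential_from_invariant Rc[OF c0] by blast
    have NS: "u \<in> C.S" if "u \<in> N" for u using N(3) that by auto
    \<comment> \<open>\<open>\<phi>\<close> is holomorphic on the image of all of \<open>R\<close>,
      so its restriction to the values attained on \<open>W\<close> is holomorphic as well.\<close>
    have "(\<lambda>t. exp (t $ 2) * (t $ 3)^3) ` W \<subseteq> C.invariant ` R"
      unfolding img using NS C.S_D(1) by (auto simp: C.invariant_t_map)
    then show ?thesis
      using \<phi>(1) holomorphic_on_subset
      by (intro exI[of _ \<phi>]) (auto simp: img NS C.invariant_t_map F \<phi>(2) \<phi>(3)[OF NS])
  qed
  show "\<exists>N W F.
           open N \<and> u0 \<in> N \<and> N \<subseteq> u_domain E U \<Lambda> \<and> open W \<and>
           biholomorphic_C3 (t_map E L T) N W \<and>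
           (\<forall>u\<in>N. F (t_map E L T u) = F_param E L T u) \<and>
           WDVV_solution 2 (vector [0, 1, 2]) (\<lambda>t. vector [t $ 1, 3, - t $ 3]) F W \<and>
           (c_fun E (x_of u0) \<noteq> 0 \<longrightarrow>
             (\<exists>\<phi>. \<phi> holomorphic_on ((\<lambda>t. exp (t $ 2) * (t $ 3)^3) ` W) \<and>
                (\<forall>t\<in>W. t $ 3 \<noteq> 0 \<and>
                   F t = 1/2 * t $ 1 * (t $ 2)^2 + 1/2 * (t $ 1)^2 * t $ 3
                         + 1 / (t $ 3) * \<phi> (exp (t $ 2) * (t $ 3)^3))))"
    by (rule exI[of _ N], rule exI[of _ W], rule exI[of _ F], intro conjI ballI impI,
      rule N(1), rule N(2), rule order_trans[OF N(3) S_sub], rule N(4), rule bij, erule F, rule W, erule \<phi>)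
qed

end
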